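(* Let $K$ be a field, $H$ a free abelian group of finite rank, and $\alpha:H\times H\to K^*$ a map with $\alpha(h,g)=\alpha(g,h)^{-1}$ and $\alpha(h_1+h_2,g)=\alpha(h_1,g)\alpha(h_2,g)$. Let $B$ be an abelian group and let $\mathcal L'',\mathcal L':B\to\mathcal G(H,\alpha)$ be two composable theta multipliers, with structure forms $\langle\cdot,\cdot\rangle''$, $\langle\cdot,\cdot\rangle'$ and left representatives $[c''_{l,b};x''_{l,b},h''_{l,b},0]$ of $\mathcal L''(b)$ and $[c'_{l,b};x'_{l,b},h'_{l,b},0]$ of $\mathcal L'(b)$. Let $\mathcal L:B\to\mathcal G(H,\alpha)$ be the pointwise composition $\mathcal L(b):=\mathcal L''(b)\circ\mathcal L'(b)$. Then: (a) $\mathcal L$ is a multiplier (i.e. a group homomorphism). Its structure form is $$\langle b_1,b_2\rangle=\langle b_1,b_2\rangle''\,\langle b_1,b_2\rangle'\,\alpha(h'_{l,b_2},h''_{l,b_1})\,\alpha(h'_{l,b_1},h''_{l,b_2}).$$ (b) If $\theta'\in\Gamma(\mathcal L')$, $\theta''\in\Gamma(\mathcal L'')$, and the product $\theta:=\theta'\theta''$ exists as a formal series, then $\theta\in\Gamma(\mathcal L)$. (c) Let $K$ be a complete normed field. If $\alpha$ is unitary and $\mathcal L'',\mathcal L'$ are ample, then $\mathcal L$ is also ample, and all the products $\theta'\theta''$ with $\theta'\in\Gamma(\mathcal L')$, $\theta''\in\Gamma(\mathcal L'')$ are well defined.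
   Context: $T(H,1)(K):=\mathrm{Hom}(H,K^* )$, written multiplicatively; for $x\in T(H,1)(K)$ and $h\in H$, $h(x)\in K^*$ denotes the value of $x$ at $h$. For $h\in H$, the point $A_h\in T(H,1)(K)$ is defined by $g(A_h)=\alpha(g,h)$ for all $g\in H$. When $K$ is normed (with multiplicative absolute value $|\cdot|$), $\alpha$ is unitary if $|\alpha(g,h)|=1$ for all $g,h$. $Al(H,\alpha)$ is the $K$-algebra with $K$-basis $e(h)$, $h\in H$, and multiplication $e(h)e(h')=\alpha(h,h')e(h+h')$; each $e(h)$ is invertible. $Af(H,\alpha)$ is the $K$-space of all formal infinite linear combinations $\sum_{h\in H}a_he(h)$, a two-sided $Al(H,\alpha)$-module. The product of two formal functions $\sum a_ge(g)$ and $\sum b_ke(k)$ is $\sum_h\left(\sum_{g+k=h}a_gb_k\alpha(g,k)\right)e(h)$; it exists (is well defined) if for every $h$ the inner family is summable, i.e. has only finitely many nonzero terms or, when $K$ is a complete normed field, is unconditionally convergent. The shift by $x\in T(H,1)(K)$ is $x^*\left(\sum a_he(h)\right)=\sum a_h\,h(x)\,e(h)$. $\widetilde{\mathcal G}(H,\alpha)$ is the group of quadruples $[c;x,g,h]$ ($c\in K^*$, $x\in T(H,1)(K)$, $g,h\in H$) with multiplication $$[c';x',g',h']\cdot[c;x,g,h]=[c'c\,g(x')\,h(x')^{-1}\alpha(g',g)\,\alpha(h',h)^{-1};\,xx',\,g+g',\,h+h'],$$ acting on $Af(H,\alpha)$ by $\Phi\mapsto c\,e(g)\,x^*(\Phi)\,e(h)^{-1}$.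 Its central subgroup $\widetilde{\mathcal G}_0(H,\alpha)=\{[1;A_h^2,h,h]\mid h\in H\}$ is the kernel of this action, and $\mathcal G(H,\alpha)=\widetilde{\mathcal G}(H,\alpha)/\widetilde{\mathcal G}_0(H,\alpha)$. Every $\Gamma\in\mathcal G(H,\alpha)$ is the class of a unique element $[c_l;x_l,h_l,0]$ (left representative) and of a unique element $[c_r;x_r,0,h_r]$ (right representative). Partial composition in $\mathcal G(H,\alpha)$: let $[c''_r;x''_r,0,h''_r]$ be the right representative of $\Gamma''$ and $[c'_l;x'_l,h'_l,0]$ the left representative of $\Gamma'$. The pair $(\Gamma'',\Gamma')$ is composable iff $x''_r=x'_l$; in that case $\Gamma''\circ\Gamma':=[c''_r;1,0,h''_r]\cdot[c'_l;x'_l,h'_l,0]\bmod\widetilde{\mathcal G}_0(H,\alpha)$. A theta multiplier is a homomorphism $\mathcal L:B\to\mathcal G(H,\alpha)$ with $B$ an abelian group; $\Gamma(\mathcal L)$ is the space of formal functions in $Af(H,\alpha)$ invariant under $\mathcal L(B)$ (theta functions with multiplier $\mathcal L$). Writing $[c_{l,b};x_{l,b},h_{l,b},0]$ for the left representative of $\mathcal L(b)$, the structure form of $\mathcal L$ is the symmetric bimultiplicative pairing $\langle b_1,b_2\rangle:=h_{l,b_2}(x_{l,b_1})\,\alpha(h_{l,b_1},h_{l,b_2})$ on $B$. Two multipliers $\mathcal L'',\mathcal L':B\to\mathcal G(H,\alpha)$ are composable if for every $b\in B$ the pair $(\mathcal L''(b),\mathcal L'(b))$ is composable. When $K$ is normed,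 $\mathcal L$ is called ample if $x_{l,b},c_{l,b}$ depend only on $h_{l,b}$, the image of $b\mapsto h_{l,b}$ has finite index in $H$, and $b\mapsto\log|\langle b,b\rangle|$ is a negative definite quadratic form on $B$ (negative on nonzero elements of $B$, and negative definite when extended to $B\otimes\mathbb R$). *)

theory Defs
  imports "HOL-Analysis.Analysis" "HOL-Algebra.Algebra"
begin

text \<open>
  The field \<open>K\<close> and the abelian groups \<open>H\<close>, \<open>B\<close> are types \<open>'k::field\<close>,
  \<open>'h::ab_group_add\<close>, \<open>'b::ab_group_add\<close>.  The groups of quadruples depend on \<open>\<alpha>\<close> and are
  records in the sense of HOL-Algebra; the following two records connect both worlds.
\<close>

definition add_group :: "'a::ab_group_add monoid" where
  "add_group = \<lparr>carrier = UNIV, monoid.mult = (+), one = 0\<rparr>"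

definition units_group :: "'k::field monoid" where
  "units_group = \<lparr>carrier = {c. c \<noteq> 0}, monoid.mult = (*), one = 1\<rparr>"

lemma comm_group_add_group: "comm_group (add_group :: 'a::ab_group_add monoid)"
  by (rule comm_groupI) (auto simp: add_group_def algebra_simps intro: exI[of _ "- x" for x])

lemma comm_group_units_group: "comm_group (units_group :: 'k::field monoid)"
  by (rule comm_groupI) (auto simp: units_group_def algebra_simps intro!: exI[of _ "inverse x" for x])

definition free_abelian_finite_rank :: "'a::ab_group_add itself \<Rightarrow> bool" where
  "free_abelian_finite_rank _ \<longleftrightarrow>
     (\<exists>n. (add_group :: 'a monoid) \<cong> free_Abelian_group {..<n::nat})"

locale skew_pairing =
  fixes \<alpha> :: "'h::ab_group_add \<Rightarrow> 'h \<Rightarrow> 'k::field"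
  assumes nonzero: "\<alpha> h g \<noteq> 0"
    and skew: "\<alpha> h g = inverse (\<alpha> g h)"
    and add_left: "\<alpha> (h1 + h2) g = \<alpha> h1 g * \<alpha> h2 g"


section \<open>The torus and formal functions\<close>

text \<open>The value \<open>h(x)\<close> of \<open>x\<close> at \<open>h\<close> is written \<open>x h\<close>.\<close>

definition torus :: "('h::ab_group_add \<Rightarrow> 'k::field) set" where
  "torus = hom add_group units_group"

definition A_pt :: "('h \<Rightarrow> 'h \<Rightarrow> 'k) \<Rightarrow> 'h \<Rightarrow> 'h \<Rightarrow> 'k" where
  "A_pt \<alpha> h = (\<lambda>g. \<alpha> g h)"

text \<open>
  A formal function \<open>\<Sum>\<^sub>h a\<^sub>h e(h)\<close> is its coefficient function \<open>a :: 'h \<Rightarrow> 'k\<close>.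
  The \<open>h\<close>-th coefficient of a product is the sum of the family \<open>conv_term \<alpha> \<Phi> \<Psi>\<close> over the
  index set \<open>{(g, k). g + k = h}\<close>.
\<close>

definition conv_term ::
  "('h \<Rightarrow> 'h \<Rightarrow> 'k::field) \<Rightarrow> ('h \<Rightarrow> 'k) \<Rightarrow> ('h \<Rightarrow> 'k) \<Rightarrow> 'h \<times> 'h \<Rightarrow> 'k" where
  "conv_term \<alpha> \<Phi> \<Psi> = (\<lambda>(g, k). \<Phi> g * \<Psi> k * \<alpha> g k)"

text \<open>
  Algebraic product: meaningful if, for every \<open>h\<close>, only finitely many terms are nonzero, in
  particular if one factor lies in \<open>Al(H, \<alpha>)\<close>, i.e. has finite support.
\<close>

definition formal_mult ::
  "('h::ab_group_add \<Rightarrow> 'h \<Rightarrow> 'k::field) \<Rightarrow> ('h \<Rightarrow> 'k) \<Rightarrow> ('h \<Rightarrow> 'k) \<Rightarrow> 'h \<Rightarrow> 'k" where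
  "formal_mult \<alpha> \<Phi> \<Psi> =
     (\<lambda>h. \<Sum>p | fst p + snd p = h \<and> conv_term \<alpha> \<Phi> \<Psi> p \<noteq> 0. conv_term \<alpha> \<Phi> \<Psi> p)"

definition e_basis :: "'h \<Rightarrow> 'h \<Rightarrow> 'k::field" where
  "e_basis h = (\<lambda>u. if u = h then 1 else 0)"

text \<open>The inverse \<open>e(h)\<^sup>-\<^sup>1 = \<alpha>(h, -h)\<^sup>-\<^sup>1 e(-h)\<close>, see \<open>e_inv_right\<close> and \<open>e_inv_left\<close> below.\<close>

definition e_inv :: "('h::ab_group_add \<Rightarrow> 'h \<Rightarrow> 'k::field) \<Rightarrow> 'h \<Rightarrow> 'h \<Rightarrow> 'k" where
  "e_inv \<alpha> h = (\<lambda>u. if u = - h then inverse (\<alpha> h (- h)) else 0)"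

lemma formal_mult_single:
  assumes "\<And>u. u \<noteq> g \<Longrightarrow> \<Phi> u = 0"
  shows "formal_mult \<alpha> \<Phi> \<Psi> u = \<Phi> g * \<Psi> (u - g) * \<alpha> g (u - g)"
proof -
  have "formal_mult \<alpha> \<Phi> \<Psi> u = (\<Sum>p\<in>{(g, u - g)}. conv_term \<alpha> \<Phi> \<Psi> p)"
    unfolding formal_mult_def
    by (rule sum.mono_neutral_cong_left)
       (use assms in \<open>force simp: conv_term_def algebra_simps\<close>)+
  thus ?thesis by (simp add: conv_term_def)
qed

lemma formal_mult_single_right:
  assumes "\<And>u. u \<noteq> g \<Longrightarrow> \<Psi> u = 0"
  shows "formal_mult \<alpha> \<Phi> \<Psi> u = \<Phi> (u - g) * \<Psi> g * \<alpha> (u - g) g"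
proof -
  have "formal_mult \<alpha> \<Phi> \<Psi> u = (\<Sum>p\<in>{(u - g, g)}. conv_term \<alpha> \<Phi> \<Psi> p)"
    unfolding formal_mult_def
    by (rule sum.mono_neutral_cong_left)
       (use assms in \<open>force simp: conv_term_def algebra_simps\<close>)+
  thus ?thesis by (simp add: conv_term_def)
qed

context skew_pairing
begin

lemma add_right: "\<alpha> h (g1 + g2) = \<alpha> h g1 * \<alpha> h g2"
  by (subst (1 2 3) skew) (simp add: add_left)

lemma zero_left [simp]: "\<alpha> 0 g = 1"
  using add_left[of 0 0 g] nonzero[of 0 g] by simp

lemma zero_right [simp]: "\<alpha> g 0 = 1"
  by (subst skew) simp

lemma minus_left: "\<alpha> (- h) g = inverse (\<alpha> h g)"
  using add_left[of h "- h" g] nonzero[of h g] by (simp add: field_simps)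

lemma minus_right: "\<alpha> h (- g) = inverse (\<alpha> h g)"
  using add_right[of h g "- g"] nonzero[of h g] by (simp add: field_simps)

lemma e_basis_mult: "formal_mult \<alpha> (e_basis g) (e_basis h) = (\<lambda>u. \<alpha> g h * e_basis (g + h) u)"
  by (rule ext, subst formal_mult_single[where g = g]) (auto simp: e_basis_def algebra_simps)

lemma e_inv_right: "formal_mult \<alpha> (e_basis h) (e_inv \<alpha> h) = e_basis 0"
  by (rule ext, subst formal_mult_single[where g = h])
     (auto simp: e_basis_def e_inv_def nonzero)

lemma e_inv_left: "formal_mult \<alpha> (e_inv \<alpha> h) (e_basis h) = e_basis 0"
  by (rule ext, subst formal_mult_single_right[where g = h])
     (auto simp: e_basis_def e_inv_def nonzero minus_left minus_right)

end

definition shift :: "('h \<Rightarrow> 'k::field) \<Rightarrow> ('h \<Rightarrow> 'k) \<Rightarrow> 'h \<Rightarrow> 'k" where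
  "shift x \<Phi> = (\<lambda>h. \<Phi> h * x h)"

definition has_formal_product ::
  "('h::ab_group_add \<Rightarrow> 'h \<Rightarrow> 'k::field) \<Rightarrow> ('h \<Rightarrow> 'k) \<Rightarrow> ('h \<Rightarrow> 'k) \<Rightarrow> ('h \<Rightarrow> 'k) \<Rightarrow> bool" where
  "has_formal_product \<alpha> \<Phi> \<Psi> \<Theta> \<longleftrightarrow>
     (\<forall>h. finite {p. fst p + snd p = h \<and> conv_term \<alpha> \<Phi> \<Psi> p \<noteq> 0}) \<and> \<Theta> = formal_mult \<alpha> \<Phi> \<Psi>"

text \<open>
  Absolute values are not taken from the class \<open>real_normed_field\<close>, as this would exclude
  non-archimedean fields.
\<close>

locale absolute_value =
  fixes nrm :: "'k::field \<Rightarrow> real"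
  assumes nrm_nonneg: "nrm c \<ge> 0"
    and nrm_eq_0_iff: "nrm c = 0 \<longleftrightarrow> c = 0"
    and nrm_mult: "nrm (c * d) = nrm c * nrm d"
    and nrm_triangle: "nrm (c + d) \<le> nrm c + nrm d"

definition nrm_dist :: "('k::field \<Rightarrow> real) \<Rightarrow> 'k \<Rightarrow> 'k \<Rightarrow> real" where
  "nrm_dist nrm = (\<lambda>c d. nrm (c - d))"

lemma (in absolute_value) Metric_space_nrm_dist: "Metric_space UNIV (nrm_dist nrm)"
proof
  have "nrm 1 * nrm 1 = nrm 1" "nrm 1 \<noteq> 0"
    using nrm_mult[of 1 1] nrm_eq_0_iff[of 1] by auto
  hence 1: "nrm 1 = 1" by simp
  have "nrm (- 1) * nrm (- 1) = 1"
    using nrm_mult[of "- 1" "- 1"] 1 by simp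
  hence "nrm (- 1) = 1"
    using nrm_nonneg[of "- 1"] by (simp add: square_eq_1_iff)
  hence minus: "nrm (- c) = nrm c" for c
    using nrm_mult[of "- 1" c] by simp
  show "nrm_dist nrm c d = nrm_dist nrm d c" for c d
    using minus[of "c - d"] by (simp add: nrm_dist_def)
  show "nrm_dist nrm c e \<le> nrm_dist nrm c d + nrm_dist nrm d e" for c d e
    using nrm_triangle[of "c - d" "d - e"] by (simp add: nrm_dist_def)
qed (simp_all add: nrm_dist_def nrm_nonneg nrm_eq_0_iff)

definition complete_absolute_value :: "('k::field \<Rightarrow> real) \<Rightarrow> bool" where
  "complete_absolute_value nrm \<longleftrightarrow>
     absolute_value nrm \<and> Metric_space.mcomplete UNIV (nrm_dist nrm)"

text \<open>
  Unconditional convergence is convergence of the net of finite partial sums.  A family with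
  only finitely many nonzero terms has an eventually constant net, so that this notion of
  product covers \<open>has_formal_product\<close>.
\<close>

definition has_nrm_product ::
  "('k::field \<Rightarrow> real) \<Rightarrow> ('h::ab_group_add \<Rightarrow> 'h \<Rightarrow> 'k) \<Rightarrow> ('h \<Rightarrow> 'k) \<Rightarrow> ('h \<Rightarrow> 'k) \<Rightarrow> ('h \<Rightarrow> 'k) \<Rightarrow> bool"
where
  "has_nrm_product nrm \<alpha> \<Phi> \<Psi> \<Theta> \<longleftrightarrow>
     (\<forall>h. limitin (Metric_space.mtopology UNIV (nrm_dist nrm))
            (sum (conv_term \<alpha> \<Phi> \<Psi>)) (\<Theta> h)
            (finite_subsets_at_top {p. fst p + snd p = h}))"


section \<open>The groups of quadruples\<close>

type_synonym ('h, 'k) quadruple = "'k \<times> ('h \<Rightarrow> 'k) \<times> 'h \<times> 'h"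

definition Gtilde :: "('h::ab_group_add \<Rightarrow> 'h \<Rightarrow> 'k::field) \<Rightarrow> ('h, 'k) quadruple monoid" where
  "Gtilde \<alpha> =
     \<lparr>carrier = {(c, x, g, h). c \<noteq> 0 \<and> x \<in> torus},
      monoid.mult = (\<lambda>(c', x', g', h') (c, x, g, h).
        (c' * c * x' g * inverse (x' h) * \<alpha> g' g * inverse (\<alpha> h' h),
         \<lambda>u. x u * x' u, g' + g, h' + h)),
      one = (1, \<lambda>_. 1, 0, 0)\<rparr>"

definition Gtilde0 :: "('h::ab_group_add \<Rightarrow> 'h \<Rightarrow> 'k::field) \<Rightarrow> ('h, 'k) quadruple set" where
  "Gtilde0 \<alpha> = range (\<lambda>h. (1, \<lambda>u. (A_pt \<alpha> h u)\<^sup>2, h, h))"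

definition G_grp :: "('h::ab_group_add \<Rightarrow> 'h \<Rightarrow> 'k::field) \<Rightarrow> ('h, 'k) quadruple set monoid" where
  "G_grp \<alpha> = Gtilde \<alpha> Mod Gtilde0 \<alpha>"

fun quad_act ::
  "('h::ab_group_add \<Rightarrow> 'h \<Rightarrow> 'k::field) \<Rightarrow> ('h, 'k) quadruple \<Rightarrow> ('h \<Rightarrow> 'k) \<Rightarrow> 'h \<Rightarrow> 'k" where
  "quad_act \<alpha> (c, x, g, h) \<Phi> =
     (\<lambda>u. c * formal_mult \<alpha> (formal_mult \<alpha> (e_basis g) (shift x \<Phi>)) (e_inv \<alpha> h) u)"

lemma torusI: "(\<And>h. x h \<noteq> 0) \<Longrightarrow> (\<And>g h. x (g + h) = x g * x h) \<Longrightarrow> x \<in> torus"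
  by (auto simp: torus_def hom_def add_group_def units_group_def)

lemma torusD:
  assumes "x \<in> torus"
  shows "x h \<noteq> 0" "x (g + h) = x g * x h" "x 0 = 1" "x (- h) = inverse (x h)"
proof -
  show nz: "x h \<noteq> 0" for h
    using assms by (auto simp: torus_def hom_def add_group_def units_group_def)
  show add: "x (g + h) = x g * x h" for g h
    using assms by (auto simp: torus_def hom_def add_group_def units_group_def)
  show "x 0 = 1"
    using add[of 0 0] nz[of 0] by simp
  thus "x (- h) = inverse (x h)"
    using add[of h "- h"] nz[of h] by (simp add: field_simps)
qed

context skew_pairing
begin

lemma A_pt_torus: "A_pt \<alpha> h \<in> torus"
  by (rule torusI) (auto simp: A_pt_def nonzero add_left)

lemma group_Gtilde: "group (Gtilde \<alpha>)"
proof (rule groupI)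
  fix p q assume "p \<in> carrier (Gtilde \<alpha>)" "q \<in> carrier (Gtilde \<alpha>)"
  thus "p \<otimes>\<^bsub>Gtilde \<alpha>\<^esub> q \<in> carrier (Gtilde \<alpha>)"
    by (auto simp: Gtilde_def torusD nonzero mult_ac intro!: torusI)
next
  show "\<one>\<^bsub>Gtilde \<alpha>\<^esub> \<in> carrier (Gtilde \<alpha>)"
    by (auto simp: Gtilde_def intro!: torusI)
next
  fix p q r
  assume "p \<in> carrier (Gtilde \<alpha>)" "q \<in> carrier (Gtilde \<alpha>)" "r \<in> carrier (Gtilde \<alpha>)"
  thus "p \<otimes>\<^bsub>Gtilde \<alpha>\<^esub> q \<otimes>\<^bsub>Gtilde \<alpha>\<^esub> r = p \<otimes>\<^bsub>Gtilde \<alpha>\<^esub> (q \<otimes>\<^bsub>Gtilde \<alpha>\<^esub> r)"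
    by (auto simp: Gtilde_def torusD(2) add_left add_right mult_ac add_ac)
next
  fix p assume "p \<in> carrier (Gtilde \<alpha>)"
  then obtain c x g h where p: "p = (c, x, g, h)" "c \<noteq> 0" "x \<in> torus"
    by (auto simp: Gtilde_def)
  show "\<one>\<^bsub>Gtilde \<alpha>\<^esub> \<otimes>\<^bsub>Gtilde \<alpha>\<^esub> p = p"
    by (simp add: p Gtilde_def)
  have "(\<lambda>u. inverse (x u)) \<in> torus"
    by (rule torusI) (simp_all add: torusD[OF p(3)])
  thus "\<exists>q\<in>carrier (Gtilde \<alpha>). q \<otimes>\<^bsub>Gtilde \<alpha>\<^esub> p = \<one>\<^bsub>Gtilde \<alpha>\<^esub>"
    by (intro bexI[of _ "(inverse c * x g * inverse (x h) * \<alpha> g g * inverse (\<alpha> h h),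
                         \<lambda>u. inverse (x u), - g, - h)"])
       (simp_all add: p(1,2) Gtilde_def torusD[OF p(3)] nonzero minus_left field_simps)
qed

lemma subgroup_Gtilde0: "subgroup (Gtilde0 \<alpha>) (Gtilde \<alpha>)"
proof -
  interpret group "Gtilde \<alpha>" by (rule group_Gtilde)
  have mult: "(1, \<lambda>u. (A_pt \<alpha> g u)\<^sup>2, g, g) \<otimes>\<^bsub>Gtilde \<alpha>\<^esub> (1, \<lambda>u. (A_pt \<alpha> h u)\<^sup>2, h, h)
      = (1, \<lambda>u. (A_pt \<alpha> (g + h) u)\<^sup>2, g + h, g + h)" for g h
    by (auto simp: Gtilde_def A_pt_def nonzero add_right fun_eq_iff power_mult_distrib)
  have closed: "(1, \<lambda>u. (A_pt \<alpha> h u)\<^sup>2, h, h) \<in> carrier (Gtilde \<alpha>)" for h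
    by (auto simp: Gtilde_def A_pt_def nonzero add_left power_mult_distrib intro!: torusI)
  have one: "\<one>\<^bsub>Gtilde \<alpha>\<^esub> = (1, \<lambda>u. (A_pt \<alpha> 0 u)\<^sup>2, 0, 0)"
    by (simp add: Gtilde_def A_pt_def)
  have inv: "inv\<^bsub>Gtilde \<alpha>\<^esub> (1, \<lambda>u. (A_pt \<alpha> h u)\<^sup>2, h, h) = (1, \<lambda>u. (A_pt \<alpha> (- h) u)\<^sup>2, - h, - h)" for h
    by (rule inv_equality) (simp_all add: mult one closed)
  show ?thesis
    by (rule subgroupI) (auto simp: Gtilde0_def closed mult inv)
qed

lemma Gtilde0_central:
  assumes "z \<in> Gtilde0 \<alpha>" "p \<in> carrier (Gtilde \<alpha>)"
  shows "z \<otimes>\<^bsub>Gtilde \<alpha>\<^esub> p = p \<otimes>\<^bsub>Gtilde \<alpha>\<^esub> z"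
proof -
  obtain k where z: "z = (1, \<lambda>u. (A_pt \<alpha> k u)\<^sup>2, k, k)"
    using assms(1) by (auto simp: Gtilde0_def)
  obtain c x g h where p: "p = (c, x, g, h)" "c \<noteq> 0" "x \<in> torus"
    using assms(2) by (auto simp: Gtilde_def)
  have "\<alpha> k g = inverse (\<alpha> g k)" "\<alpha> k h = inverse (\<alpha> h k)"
    by (rule skew)+
  thus ?thesis
    using z p by (simp add: Gtilde_def A_pt_def torusD nonzero fun_eq_iff field_simps power2_eq_square)
qed

lemma normal_Gtilde0: "Gtilde0 \<alpha> \<lhd> Gtilde \<alpha>"
proof (rule group.normalI[OF group_Gtilde subgroup_Gtilde0], intro ballI)
  fix p assume "p \<in> carrier (Gtilde \<alpha>)"
  thus "Gtilde0 \<alpha> #>\<^bsub>Gtilde \<alpha>\<^esub> p = p <#\<^bsub>Gtilde \<alpha>\<^esub> Gtilde0 \<alpha>"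
    unfolding r_coset_def l_coset_def by (intro SUP_cong refl) (metis Gtilde0_central)
qed

lemma group_G_grp: "group (G_grp \<alpha>)"
  unfolding G_grp_def by (rule normal.factorgroup_is_group[OF normal_Gtilde0])

lemma quad_act_eq:
  "quad_act \<alpha> (c, x, g, h) \<Phi> u =
     c * \<alpha> g (u + h - g) * \<alpha> h u * \<Phi> (u + h - g) * x (u + h - g)"
proof -
  have *: "formal_mult \<alpha> (e_basis g) (shift x \<Phi>) v = \<Phi> (v - g) * x (v - g) * \<alpha> g (v - g)" for v
    by (subst formal_mult_single[where g = g]) (auto simp: e_basis_def shift_def)
  have "\<alpha> u h = inverse (\<alpha> h u)" by (rule skew)
  thus ?thesis
    unfolding quad_act.simps
    by (subst formal_mult_single_right[where g = "- h"])
       (simp_all add: * e_inv_def minus_right add_left nonzero field_simps)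
qed

lemma Gtilde0_acts_trivially:
  assumes "z \<in> Gtilde0 \<alpha>"
  shows "quad_act \<alpha> z \<Phi> = \<Phi>"
proof
  fix u
  obtain h where z: "z = (1, \<lambda>u. (A_pt \<alpha> h u)\<^sup>2, h, h)"
    using assms by (auto simp: Gtilde0_def)
  have "\<alpha> h u = inverse (\<alpha> u h)" by (rule skew)
  thus "quad_act \<alpha> z \<Phi> u = \<Phi> u"
    by (simp add: z quad_act_eq A_pt_def nonzero minus_right minus_left add_left add_right
          field_simps power2_eq_square del: quad_act.simps)
qed

lemma quad_act_mult:
  assumes "p \<in> carrier (Gtilde \<alpha>)" "q \<in> carrier (Gtilde \<alpha>)"
  shows "quad_act \<alpha> (p \<otimes>\<^bsub>Gtilde \<alpha>\<^esub> q) \<Phi> = quad_act \<alpha> p (quad_act \<alpha> q \<Phi>)"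
proof
  fix u
  obtain c x g h where q: "q = (c, x, g, h)" "c \<noteq> 0" "x \<in> torus"
    using assms(2) by (auto simp: Gtilde_def)
  obtain c' x' g' h' where p: "p = (c', x', g', h')" "c' \<noteq> 0" "x' \<in> torus"
    using assms(1) by (auto simp: Gtilde_def)
  define v where "v = u + (h' + h) - (g' + g)"
  have u: "u = v + g' + g - h' - h" and v: "u + h' - g' = v + g - h" "v + g - h + h - g = v"
    by (simp_all add: v_def)
  have sk: "\<alpha> h h' = inverse (\<alpha> h' h)" "\<alpha> h g' = inverse (\<alpha> g' h)"
    by (rule skew)+
  have xm: "x' (a - b) = x' a * inverse (x' b)" for a b
    using torusD(2)[OF p(3), of a "- b"] by (simp add: torusD(4)[OF p(3)])
  have am: "\<alpha> a (b - d) = \<alpha> a b * inverse (\<alpha> a d)" for a b d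
    using add_right[of a b "- d"] by (simp add: minus_right)
  have "quad_act \<alpha> p (quad_act \<alpha> q \<Phi>) u =
     c' * \<alpha> g' (v + g - h) * \<alpha> h' u * (c * \<alpha> g v * \<alpha> h (v + g - h) * \<Phi> v * x v)
       * x' (v + g - h)"
    unfolding p q quad_act_eq v ..
  also have "\<dots> = quad_act \<alpha> (p \<otimes>\<^bsub>Gtilde \<alpha>\<^esub> q) \<Phi> u"
    unfolding p q Gtilde_def monoid.simps prod.case quad_act_eq v_def[symmetric]
    unfolding u
    by (simp add: xm am add_left add_right nonzero sk torusD[OF p(3)] field_simps)
  finally show "quad_act \<alpha> (p \<otimes>\<^bsub>Gtilde \<alpha>\<^esub> q) \<Phi> u = quad_act \<alpha> p (quad_act \<alpha> q \<Phi>) u" ..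
qed

lemma mem_coset_iff:
  "q \<in> Gtilde0 \<alpha> #>\<^bsub>Gtilde \<alpha>\<^esub> (c, x, g, h) \<longleftrightarrow>
     (\<exists>k. q = (c * (\<alpha> g k)\<^sup>2 * inverse ((\<alpha> h k)\<^sup>2) * \<alpha> k g * inverse (\<alpha> k h),
                \<lambda>u. x u * (\<alpha> u k)\<^sup>2, k + g, k + h))"
  by (auto simp: r_coset_def Gtilde0_def Gtilde_def A_pt_def)

lemma ex1_left_rep:
  assumes "\<Gamma> \<in> carrier (G_grp \<alpha>)"
  shows "\<exists>!(c, x, h). (c, x, h, 0) \<in> \<Gamma>"
proof -
  obtain c x g h where \<Gamma>: "\<Gamma> = Gtilde0 \<alpha> #>\<^bsub>Gtilde \<alpha>\<^esub> (c, x, g, h)"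
    using assms by (auto simp: G_grp_def FactGroup_def RCOSETS_def Gtilde_def)
  have k: "k + h = 0 \<longleftrightarrow> k = - h" "0 = k + h \<longleftrightarrow> k = - h" for k
    by (auto simp: eq_neg_iff_add_eq_0)
  show ?thesis
    unfolding \<Gamma> mem_coset_iff
    by (rule ex1I[of _ "(c * (\<alpha> g (- h))\<^sup>2 * inverse ((\<alpha> h (- h))\<^sup>2) * \<alpha> (- h) g * inverse (\<alpha> (- h) h),
                         \<lambda>u. x u * (\<alpha> u (- h))\<^sup>2, - h + g)"])
       (auto simp only: prod.case prod.inject k split: prod.splits)
qed

lemma ex1_right_rep:
  assumes "\<Gamma> \<in> carrier (G_grp \<alpha>)"
  shows "\<exists>!(c, x, h). (c, x, 0, h) \<in> \<Gamma>"
proof -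
  obtain c x g h where \<Gamma>: "\<Gamma> = Gtilde0 \<alpha> #>\<^bsub>Gtilde \<alpha>\<^esub> (c, x, g, h)"
    using assms by (auto simp: G_grp_def FactGroup_def RCOSETS_def Gtilde_def)
  have k: "k + g = 0 \<longleftrightarrow> k = - g" "0 = k + g \<longleftrightarrow> k = - g" for k
    by (auto simp: eq_neg_iff_add_eq_0)
  show ?thesis
    unfolding \<Gamma> mem_coset_iff
    by (rule ex1I[of _ "(c * (\<alpha> g (- g))\<^sup>2 * inverse ((\<alpha> h (- g))\<^sup>2) * \<alpha> (- g) g * inverse (\<alpha> (- g) h),
                         \<lambda>u. x u * (\<alpha> u (- g))\<^sup>2, - g + h)"])
       (auto simp only: prod.case prod.inject k split: prod.splits)
qed

end

text \<open>
  Elements of \<open>G_grp \<alpha>\<close> are cosets, so the left (right) representative is the unique member of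
  the coset with last (third) component \<open>0\<close>; see \<open>ex1_left_rep\<close>, \<open>ex1_right_rep\<close>.
\<close>

definition left_rep :: "('h::ab_group_add, 'k::field) quadruple set \<Rightarrow> 'k \<times> ('h \<Rightarrow> 'k) \<times> 'h" where
  "left_rep \<Gamma> = (THE (c, x, h). (c, x, h, 0) \<in> \<Gamma>)"

definition right_rep :: "('h::ab_group_add, 'k::field) quadruple set \<Rightarrow> 'k \<times> ('h \<Rightarrow> 'k) \<times> 'h" where
  "right_rep \<Gamma> = (THE (c, x, h). (c, x, 0, h) \<in> \<Gamma>)"

definition c_l where "c_l \<Gamma> = fst (left_rep \<Gamma>)"
definition x_l where "x_l \<Gamma> = fst (snd (left_rep \<Gamma>))"
definition h_l where "h_l \<Gamma> = snd (snd (left_rep \<Gamma>))"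

definition c_r where "c_r \<Gamma> = fst (right_rep \<Gamma>)"
definition x_r where "x_r \<Gamma> = fst (snd (right_rep \<Gamma>))"
definition h_r where "h_r \<Gamma> = snd (snd (right_rep \<Gamma>))"

definition composable ::
  "('h::ab_group_add, 'k::field) quadruple set \<Rightarrow> ('h, 'k) quadruple set \<Rightarrow> bool" where
  "composable \<Gamma>'' \<Gamma>' \<longleftrightarrow> x_r \<Gamma>'' = x_l \<Gamma>'"

definition G_compose ::
  "('h::ab_group_add \<Rightarrow> 'h \<Rightarrow> 'k::field) \<Rightarrow> ('h, 'k) quadruple set \<Rightarrow> ('h, 'k) quadruple set
     \<Rightarrow> ('h, 'k) quadruple set" where
  "G_compose \<alpha> \<Gamma>'' \<Gamma>' =
     Gtilde0 \<alpha> #>\<^bsub>Gtilde \<alpha>\<^esub>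
       ((c_r \<Gamma>'', \<lambda>_. 1, 0, h_r \<Gamma>'') \<otimes>\<^bsub>Gtilde \<alpha>\<^esub> (c_l \<Gamma>', x_l \<Gamma>', h_l \<Gamma>', 0))"


section \<open>Theta multipliers\<close>

definition theta_multiplier ::
  "('h::ab_group_add \<Rightarrow> 'h \<Rightarrow> 'k::field) \<Rightarrow> ('b::ab_group_add \<Rightarrow> ('h, 'k) quadruple set) \<Rightarrow> bool" where
  "theta_multiplier \<alpha> L \<longleftrightarrow> L \<in> hom add_group (G_grp \<alpha>)"

text \<open>
  An element of the quotient acts through any of its representatives, because \<open>Gtilde0 \<alpha>\<close> acts
  trivially (\<open>Gtilde0_acts_trivially\<close>, \<open>quad_act_mult\<close>).
\<close>

definition theta_functions ::
  "('h::ab_group_add \<Rightarrow> 'h \<Rightarrow> 'k::field) \<Rightarrow> ('b \<Rightarrow> ('h, 'k) quadruple set) \<Rightarrow> ('h \<Rightarrow> 'k) set" where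
  "theta_functions \<alpha> L = {\<Phi>. \<forall>b. \<forall>q\<in>L b. quad_act \<alpha> q \<Phi> = \<Phi>}"

definition structure_form ::
  "('h::ab_group_add \<Rightarrow> 'h \<Rightarrow> 'k::field) \<Rightarrow> ('b \<Rightarrow> ('h, 'k) quadruple set) \<Rightarrow> 'b \<Rightarrow> 'b \<Rightarrow> 'k" where
  "structure_form \<alpha> L b1 b2 = x_l (L b1) (h_l (L b2)) * \<alpha> (h_l (L b1)) (h_l (L b2))"

text \<open>
  \<open>B \<otimes> \<real>\<close> is the real vector space with basis \<open>B\<close> modulo the span of all
  \<open>[b + b'] - [b] - [b']\<close>, which is the following set.
\<close>

inductive_set tensor_relations :: "('b::ab_group_add \<Rightarrow>\<^sub>0 real) set" where
  zero: "0 \<in> tensor_relations"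
| step: "r \<in> tensor_relations \<Longrightarrow>
    r + (Poly_Mapping.single (b + b') t - Poly_Mapping.single b t - Poly_Mapping.single b' t)
      \<in> tensor_relations"

text \<open>
  For a symmetric biadditive \<open>\<beta>\<close> on \<open>B\<close>, the quadratic form \<open>b \<mapsto> \<beta>(b, b)\<close> extends to
  \<open>B \<otimes> \<real>\<close> by sending the class of \<open>\<Sum>\<^sub>b r\<^sub>b [b]\<close> to \<open>\<Sum>\<^sub>b \<Sum>\<^sub>b\<^sub>' r\<^sub>b r\<^sub>b\<^sub>' \<beta>(b, b')\<close>.
\<close>

definition negative_definite :: "('b::ab_group_add \<Rightarrow> 'b \<Rightarrow> real) \<Rightarrow> bool" where
  "negative_definite \<beta> \<longleftrightarrow>
     (\<forall>b. b \<noteq> 0 \<longrightarrow> \<beta> b b < 0) \<and>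
     (\<forall>r. r \<notin> tensor_relations \<longrightarrow>
        (\<Sum>b\<in>Poly_Mapping.keys r. \<Sum>b'\<in>Poly_Mapping.keys r.
           Poly_Mapping.lookup r b * Poly_Mapping.lookup r b' * \<beta> b b') < 0)"

definition unitary :: "('k::field \<Rightarrow> real) \<Rightarrow> ('h \<Rightarrow> 'h \<Rightarrow> 'k) \<Rightarrow> bool" where
  "unitary nrm \<alpha> \<longleftrightarrow> (\<forall>g h. nrm (\<alpha> g h) = 1)"

definition ample ::
  "('k::field \<Rightarrow> real) \<Rightarrow> ('h::ab_group_add \<Rightarrow> 'h \<Rightarrow> 'k)
     \<Rightarrow> ('b::ab_group_add \<Rightarrow> ('h, 'k) quadruple set) \<Rightarrow> bool" where
  "ample nrm \<alpha> L \<longleftrightarrow>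
     (\<forall>b1 b2. h_l (L b1) = h_l (L b2) \<longrightarrow> x_l (L b1) = x_l (L b2) \<and> c_l (L b1) = c_l (L b2)) \<and>
     finite (rcosets\<^bsub>add_group\<^esub> (range (\<lambda>b. h_l (L b)))) \<and>
     negative_definite (\<lambda>b1 b2. ln (nrm (structure_form \<alpha> L b1 b2)))"

end

theory Submission
  imports Defs
begin

text \<open>
  Everything is computed on left representatives.  Let \<open>[c''; x'', h'', 0]\<close> and
  \<open>[c'; x', h', 0]\<close> represent \<open>\<Gamma>''\<close> and \<open>\<Gamma>'\<close>.  Moving \<open>h''\<close> to the right-hand side by an element
  of the central subgroup shows that composability means \<open>x''(u) = x'(u) \<alpha>(u, h'')\<^sup>2\<close>, and that
  the composition has the left representative
  \<open>[c'' c' \<alpha>(h', h''); x'', h' + h'', 0]\<close> (lemma \<open>compose_left_rep\<close>).  A map into the group of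
  classes is a multiplier iff \<open>h\<close> and \<open>x\<close> are homomorphisms and \<open>c\<close> is quadratic with the
  structure form as its polarization (lemma \<open>theta_multiplier_iff\<close>).  Both parts of the first
  claim are then identities between values of \<open>\<alpha>\<close> and of \<open>x''\<close>.

  For the products, the translation \<open>(g, k) \<mapsto> (h'\<^sub>b + g, h''\<^sub>b + k)\<close> maps the pairs with
  \<open>g + k = u\<close> bijectively to the pairs with sum \<open>h'\<^sub>b + h''\<^sub>b + u\<close>.  The functional equations of
  \<open>\<theta>'\<close> and \<open>\<theta>''\<close> multiply the term at \<open>(g, k)\<close> by a factor which, thanks to composability,
  depends on \<open>u\<close> only, and which is the factor in the functional equation for \<open>\<L>\<close>
  (lemma \<open>conv_term_translate\<close>).  So the functional equation of the product holds term by term.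

  In the ample case, taking the logarithm of the absolute value kills the unitary pairing, so that
  the logarithmic form of \<open>\<L>\<close> is the sum of those of \<open>\<L>''\<close> and \<open>\<L>'\<close> and hence negative definite.
  It follows that \<open>b \<mapsto> h\<^sub>b\<close> is injective.  Its image has finite index because \<open>B\<close> has
  full rank, being of finite index in \<open>H\<close> via \<open>h'\<close>, and because an injective endomorphism of a
  lattice has a finite cokernel; the latter is proved by counting lattice points in cubes
  (lemmas \<open>card_incongruent_le\<close> and \<open>finite_index_range\<close>).

  Finally, a theta function of an ample multiplier is absolutely summable (lemma
  \<open>ample_theta_summable\<close>).  Along a full sublattice of translations \<open>h\<^sub>b\<close> the logarithm of its
  absolute value is a quadratic polynomial whose leading part is half the logarithmic form.
  This part is at most \<open>-\<epsilon>\<close> times a Euclidean norm by compactness of the sphere, which is where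
  definiteness on \<open>B \<otimes> \<real>\<close>, and not just on \<open>B\<close>, enters.  An absolutely summable function times a
  bounded one is well defined over a complete field (lemma \<open>nrm_product_exists\<close>).
\<close>

section \<open>Left representatives and composition\<close>

context skew_pairing
begin

text \<open>
  Skew-symmetry is meant multiplicatively and only forces \<open>\<alpha>(h, h) = \<plusminus>1\<close>.
\<close>
lemma pairing_diag_square: "\<alpha> h h * \<alpha> h h = 1"
  using skew[of h h] nonzero[of h h] by (metis right_inverse)

lemma left_rep_mem:
  assumes "\<Gamma> \<in> carrier (G_grp \<alpha>)"
  shows "(c_l \<Gamma>, x_l \<Gamma>, h_l \<Gamma>, 0) \<in> \<Gamma>"
  using theI'[OF ex1_left_rep[OF assms]]
  by (simp add: c_l_def x_l_def h_l_def left_rep_def case_prod_unfold)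

lemma left_rep_unique:
  assumes "\<Gamma> \<in> carrier (G_grp \<alpha>)" "(c, x, h, 0) \<in> \<Gamma>"
  shows "c_l \<Gamma> = c" "x_l \<Gamma> = x" "h_l \<Gamma> = h"
proof -
  have "left_rep \<Gamma> = (c, x, h)"
    unfolding left_rep_def
    by (rule the1_equality[OF ex1_left_rep[OF assms(1)]]) (simp add: assms(2))
  thus "c_l \<Gamma> = c" "x_l \<Gamma> = x" "h_l \<Gamma> = h"
    by (simp_all add: c_l_def x_l_def h_l_def)
qed

lemma right_rep_unique:
  assumes "\<Gamma> \<in> carrier (G_grp \<alpha>)" "(c, x, 0, h) \<in> \<Gamma>"
  shows "c_r \<Gamma> = c" "x_r \<Gamma> = x" "h_r \<Gamma> = h"
proof -
  have "right_rep \<Gamma> = (c, x, h)"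
    unfolding right_rep_def
    by (rule the1_equality[OF ex1_right_rep[OF assms(1)]]) (simp add: assms(2))
  thus "c_r \<Gamma> = c" "x_r \<Gamma> = x" "h_r \<Gamma> = h"
    by (simp_all add: c_r_def x_r_def h_r_def)
qed

lemma coset_in_carrier: "p \<in> carrier (Gtilde \<alpha>) \<Longrightarrow> Gtilde0 \<alpha> #>\<^bsub>Gtilde \<alpha>\<^esub> p \<in> carrier (G_grp \<alpha>)"
  by (auto simp: G_grp_def FactGroup_def RCOSETS_def)

lemma carrier_G_subset: "\<Gamma> \<in> carrier (G_grp \<alpha>) \<Longrightarrow> \<Gamma> \<subseteq> carrier (Gtilde \<alpha>)"
  unfolding G_grp_def
  using subgroup.rcosets_carrier[OF subgroup_Gtilde0 group_Gtilde] by (simp add: FactGroup_def)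

text \<open>
  Classes are compared through any of their elements, in particular through left representatives.
\<close>
lemma coset_eq:
  assumes "\<Gamma> \<in> carrier (G_grp \<alpha>)" "p \<in> \<Gamma>"
  shows "\<Gamma> = Gtilde0 \<alpha> #>\<^bsub>Gtilde \<alpha>\<^esub> p"
proof -
  obtain q where q: "q \<in> carrier (Gtilde \<alpha>)" "\<Gamma> = Gtilde0 \<alpha> #>\<^bsub>Gtilde \<alpha>\<^esub> q"
    using assms(1) by (auto simp: G_grp_def FactGroup_def RCOSETS_def)
  show ?thesis
    using group.repr_independence[OF group_Gtilde, of p "Gtilde0 \<alpha>" q] q assms(2) subgroup_Gtilde0
    by simp
qed

lemma left_rep_carrier:
  assumes "\<Gamma> \<in> carrier (G_grp \<alpha>)"
  shows "c_l \<Gamma> \<noteq> 0" "x_l \<Gamma> \<in> torus"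
  using carrier_G_subset[OF assms] left_rep_mem[OF assms] by (auto simp: Gtilde_def)

lemma G_eqI:
  assumes "\<Gamma> \<in> carrier (G_grp \<alpha>)" "\<Delta> \<in> carrier (G_grp \<alpha>)"
    and "c_l \<Gamma> = c_l \<Delta>" "x_l \<Gamma> = x_l \<Delta>" "h_l \<Gamma> = h_l \<Delta>"
  shows "\<Gamma> = \<Delta>"
  using coset_eq[OF assms(1) left_rep_mem[OF assms(1)]] coset_eq[OF assms(2) left_rep_mem[OF assms(2)]]
    assms(3-5) by simp

text \<open>
  Left representatives are closed under multiplication, so the product of two classes is computed
  without passing through the central subgroup.  The factor in parentheses becomes the structure
  form.
\<close>
lemma mult_left_rep:
  assumes "\<Gamma> \<in> carrier (G_grp \<alpha>)" "\<Delta> \<in> carrier (G_grp \<alpha>)"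
  shows "c_l (\<Gamma> \<otimes>\<^bsub>G_grp \<alpha>\<^esub> \<Delta>) = c_l \<Gamma> * c_l \<Delta> * (x_l \<Gamma> (h_l \<Delta>) * \<alpha> (h_l \<Gamma>) (h_l \<Delta>))"
    "x_l (\<Gamma> \<otimes>\<^bsub>G_grp \<alpha>\<^esub> \<Delta>) = (\<lambda>u. x_l \<Gamma> u * x_l \<Delta> u)"
    "h_l (\<Gamma> \<otimes>\<^bsub>G_grp \<alpha>\<^esub> \<Delta>) = h_l \<Gamma> + h_l \<Delta>"
proof -
  interpret group "G_grp \<alpha>" by (rule group_G_grp)
  define p where "p = (c_l \<Gamma>, x_l \<Gamma>, h_l \<Gamma>, 0) \<otimes>\<^bsub>Gtilde \<alpha>\<^esub> (c_l \<Delta>, x_l \<Delta>, h_l \<Delta>, 0)"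
  have p: "p = (c_l \<Gamma> * c_l \<Delta> * (x_l \<Gamma> (h_l \<Delta>) * \<alpha> (h_l \<Gamma>) (h_l \<Delta>)),
                \<lambda>u. x_l \<Gamma> u * x_l \<Delta> u, h_l \<Gamma> + h_l \<Delta>, 0)"
    by (simp add: p_def Gtilde_def torusD[OF left_rep_carrier(2)[OF assms(1)]] mult_ac)
  have "\<Gamma> \<otimes>\<^bsub>G_grp \<alpha>\<^esub> \<Delta> = \<Gamma> <#>\<^bsub>Gtilde \<alpha>\<^esub> \<Delta>"
    by (simp add: G_grp_def FactGroup_def)
  hence "p \<in> \<Gamma> \<otimes>\<^bsub>G_grp \<alpha>\<^esub> \<Delta>"
    unfolding p_def set_mult_def using left_rep_mem[OF assms(1)] left_rep_mem[OF assms(2)] by auto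
  with left_rep_unique[OF m_closed[OF assms]]
  show "c_l (\<Gamma> \<otimes>\<^bsub>G_grp \<alpha>\<^esub> \<Delta>) = c_l \<Gamma> * c_l \<Delta> * (x_l \<Gamma> (h_l \<Delta>) * \<alpha> (h_l \<Gamma>) (h_l \<Delta>))"
    "x_l (\<Gamma> \<otimes>\<^bsub>G_grp \<alpha>\<^esub> \<Delta>) = (\<lambda>u. x_l \<Gamma> u * x_l \<Delta> u)"
    "h_l (\<Gamma> \<otimes>\<^bsub>G_grp \<alpha>\<^esub> \<Delta>) = h_l \<Gamma> + h_l \<Delta>"
    unfolding p by blast+
qed

text \<open>
  Multiplying the left representative by the central element with index \<open>-h\<close> moves \<open>h\<close> to the
  other side.
\<close>
lemma right_rep_eq:
  assumes "\<Gamma> \<in> carrier (G_grp \<alpha>)"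
  shows "c_r \<Gamma> = c_l \<Gamma> * \<alpha> (h_l \<Gamma>) (h_l \<Gamma>)"
    "x_r \<Gamma> = (\<lambda>u. x_l \<Gamma> u * inverse ((\<alpha> u (h_l \<Gamma>))\<^sup>2))"
    "h_r \<Gamma> = - h_l \<Gamma>"
proof -
  define c x h where "c = c_l \<Gamma>" and "x = x_l \<Gamma>" and "h = h_l \<Gamma>"
  have inverse_diag: "inverse (\<alpha> h h) = \<alpha> h h"
    by (rule inverse_unique[OF pairing_diag_square])
  have "\<Gamma> = Gtilde0 \<alpha> #>\<^bsub>Gtilde \<alpha>\<^esub> (c, x, h, 0)"
    unfolding c_def x_def h_def by (rule coset_eq[OF assms left_rep_mem[OF assms]])
  moreover have "(c * \<alpha> h h, \<lambda>u. x u * inverse ((\<alpha> u h)\<^sup>2), 0, - h)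
      \<in> Gtilde0 \<alpha> #>\<^bsub>Gtilde \<alpha>\<^esub> (c, x, h, 0)"
    unfolding mem_coset_iff
    by (rule exI[of _ "- h"])
       (simp add: minus_left minus_right power2_eq_square pairing_diag_square inverse_diag mult.assoc)
  ultimately show "c_r \<Gamma> = c_l \<Gamma> * \<alpha> (h_l \<Gamma>) (h_l \<Gamma>)"
    "x_r \<Gamma> = (\<lambda>u. x_l \<Gamma> u * inverse ((\<alpha> u (h_l \<Gamma>))\<^sup>2))"
    "h_r \<Gamma> = - h_l \<Gamma>"
    using right_rep_unique[OF assms] unfolding c_def x_def h_def by blast+
qed

lemma composable_iff:
  assumes "\<Gamma>'' \<in> carrier (G_grp \<alpha>)"
  shows "composable \<Gamma>'' \<Gamma>' \<longleftrightarrow> (\<forall>u. x_l \<Gamma>'' u = x_l \<Gamma>' u * (\<alpha> u (h_l \<Gamma>''))\<^sup>2)"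
  by (auto simp: composable_def right_rep_eq[OF assms] fun_eq_iff nonzero field_simps)

text \<open>
  The composition is the class of \<open>[c'' c' \<alpha>(h'', h''); x', h', -h'']\<close>; multiplying by the central
  element with index \<open>h''\<close> turns \<open>x'\<close> into \<open>x'(u) \<alpha>(u, h'')\<^sup>2\<close>, which is \<open>x''\<close> by composability.
\<close>
lemma compose_left_rep:
  assumes "\<Gamma>'' \<in> carrier (G_grp \<alpha>)" "\<Gamma>' \<in> carrier (G_grp \<alpha>)" "composable \<Gamma>'' \<Gamma>'"
  shows "G_compose \<alpha> \<Gamma>'' \<Gamma>' \<in> carrier (G_grp \<alpha>)"
    "c_l (G_compose \<alpha> \<Gamma>'' \<Gamma>') = c_l \<Gamma>'' * c_l \<Gamma>' * \<alpha> (h_l \<Gamma>') (h_l \<Gamma>'')"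
    "x_l (G_compose \<alpha> \<Gamma>'' \<Gamma>') = x_l \<Gamma>''"
    "h_l (G_compose \<alpha> \<Gamma>'' \<Gamma>') = h_l \<Gamma>' + h_l \<Gamma>''"
proof -
  define c c' x h h'
    where "c = c_l \<Gamma>''" and "c' = c_l \<Gamma>'" and "x = x_l \<Gamma>'" and "h = h_l \<Gamma>''" and "h' = h_l \<Gamma>'"
  have sk: "\<alpha> h h' = inverse (\<alpha> h' h)" by (rule skew)
  have nz: "c \<noteq> 0" "c' \<noteq> 0" "x \<in> torus"
    using left_rep_carrier[OF assms(1)] left_rep_carrier[OF assms(2)]
    by (simp_all add: c_def c'_def x_def)
  let ?p = "(c * c' * \<alpha> h h, x, h', - h)"
  have p: "?p \<in> carrier (Gtilde \<alpha>)"
    using nz by (simp add: Gtilde_def nonzero)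
  have eq: "G_compose \<alpha> \<Gamma>'' \<Gamma>' = Gtilde0 \<alpha> #>\<^bsub>Gtilde \<alpha>\<^esub> ?p"
    unfolding G_compose_def right_rep_eq[OF assms(1)]
    by (simp add: Gtilde_def c_def c'_def x_def h_def h'_def mult_ac)
  show carrier: "G_compose \<alpha> \<Gamma>'' \<Gamma>' \<in> carrier (G_grp \<alpha>)"
    unfolding eq by (rule coset_in_carrier[OF p])
  have 1: "c * c' * \<alpha> h' h = c * c' * \<alpha> h h * (\<alpha> h' h)\<^sup>2 * inverse ((\<alpha> (- h) h)\<^sup>2) * \<alpha> h h' * inverse (\<alpha> h (- h))"
    using pairing_diag_square nonzero[of h h] nonzero[of h' h]
    by (simp add: sk minus_left minus_right power2_eq_square field_simps)
  have 2: "x_l \<Gamma>'' = (\<lambda>u. x u * (\<alpha> u h)\<^sup>2)"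
    using assms(3) unfolding composable_iff[OF assms(1)] x_def h_def by blast
  have "(c * c' * \<alpha> h' h, x_l \<Gamma>'', h' + h, 0) \<in> G_compose \<alpha> \<Gamma>'' \<Gamma>'"
    unfolding eq mem_coset_iff 1 2 by (rule exI[of _ h]) (simp add: add.commute)
  from left_rep_unique[OF carrier this]
  show "c_l (G_compose \<alpha> \<Gamma>'' \<Gamma>') = c_l \<Gamma>'' * c_l \<Gamma>' * \<alpha> (h_l \<Gamma>') (h_l \<Gamma>'')"
    "x_l (G_compose \<alpha> \<Gamma>'' \<Gamma>') = x_l \<Gamma>''"
    "h_l (G_compose \<alpha> \<Gamma>'' \<Gamma>') = h_l \<Gamma>' + h_l \<Gamma>''"
    by (simp_all add: c_def c'_def h_def h'_def)
qed

text \<open>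
  The homomorphism property in coordinates: \<open>c\<close> fails to be multiplicative exactly by the
  structure form.
\<close>
lemma theta_multiplier_iff:
  "theta_multiplier \<alpha> L \<longleftrightarrow>
    (\<forall>b. L b \<in> carrier (G_grp \<alpha>)) \<and>
    (\<forall>b1 b2. c_l (L (b1 + b2)) = c_l (L b1) * c_l (L b2) * structure_form \<alpha> L b1 b2 \<and>
             x_l (L (b1 + b2)) = (\<lambda>u. x_l (L b1) u * x_l (L b2) u) \<and>
             h_l (L (b1 + b2)) = h_l (L b1) + h_l (L b2))"
proof (intro iffI conjI allI)
  assume "theta_multiplier \<alpha> L"
  hence L: "L b \<in> carrier (G_grp \<alpha>)" "L (b1 + b2) = L b1 \<otimes>\<^bsub>G_grp \<alpha>\<^esub> L b2" for b b1 b2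
    by (auto simp: theta_multiplier_def hom_def add_group_def)
  fix b1 b2
  show "L b1 \<in> carrier (G_grp \<alpha>)" by (rule L)
  show "c_l (L (b1 + b2)) = c_l (L b1) * c_l (L b2) * structure_form \<alpha> L b1 b2"
    "x_l (L (b1 + b2)) = (\<lambda>u. x_l (L b1) u * x_l (L b2) u)"
    "h_l (L (b1 + b2)) = h_l (L b1) + h_l (L b2)"
    by (simp_all add: L(2) mult_left_rep[OF L(1) L(1)] structure_form_def)
next
  interpret group "G_grp \<alpha>" by (rule group_G_grp)
  assume *: "(\<forall>b. L b \<in> carrier (G_grp \<alpha>)) \<and>
    (\<forall>b1 b2. c_l (L (b1 + b2)) = c_l (L b1) * c_l (L b2) * structure_form \<alpha> L b1 b2 \<and>
             x_l (L (b1 + b2)) = (\<lambda>u. x_l (L b1) u * x_l (L b2) u) \<and>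
             h_l (L (b1 + b2)) = h_l (L b1) + h_l (L b2))"
  have "L (b1 + b2) = L b1 \<otimes>\<^bsub>G_grp \<alpha>\<^esub> L b2" for b1 b2
    by (rule G_eqI) (use * in \<open>simp_all add: mult_left_rep structure_form_def\<close>)
  with * show "theta_multiplier \<alpha> L"
    by (auto simp: theta_multiplier_def hom_def add_group_def)
qed

text \<open>
  Invariance under a class only has to be tested on the left representative, because the central
  subgroup acts trivially; it is then a functional equation under translation by \<open>h\<close>.
\<close>
lemma theta_functions_iff:
  assumes "theta_multiplier \<alpha> L"
  shows "\<Phi> \<in> theta_functions \<alpha> L \<longleftrightarrow>
    (\<forall>b u. \<Phi> (h_l (L b) + u) = c_l (L b) * \<alpha> (h_l (L b)) u * x_l (L b) u * \<Phi> u)"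
proof -
  have L: "L b \<in> carrier (G_grp \<alpha>)" for b
    using assms by (simp add: theta_multiplier_iff)
  have "(\<forall>q\<in>L b. quad_act \<alpha> q \<Phi> = \<Phi>) \<longleftrightarrow> quad_act \<alpha> (c_l (L b), x_l (L b), h_l (L b), 0) \<Phi> = \<Phi>"
    (is "?lhs \<longleftrightarrow> quad_act \<alpha> ?p \<Phi> = \<Phi>") for b
  proof
    assume inv: "quad_act \<alpha> ?p \<Phi> = \<Phi>"
    have p: "?p \<in> carrier (Gtilde \<alpha>)"
      using left_rep_mem[OF L] carrier_G_subset[OF L] by blast
    show ?lhs
    proof
      fix q assume "q \<in> L b"
      then obtain z where z: "z \<in> Gtilde0 \<alpha>" "q = z \<otimes>\<^bsub>Gtilde \<alpha>\<^esub> ?p"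
        using coset_eq[OF L left_rep_mem[OF L], of b] unfolding r_coset_def by blast
      have "z \<in> carrier (Gtilde \<alpha>)"
        using subgroup.subset[OF subgroup_Gtilde0] z(1) by blast
      thus "quad_act \<alpha> q \<Phi> = \<Phi>"
        unfolding z(2) by (simp add: quad_act_mult[OF _ p] inv Gtilde0_acts_trivially[OF z(1)] del: quad_act.simps)
    qed
  qed (use left_rep_mem[OF L] in blast)
  moreover have "quad_act \<alpha> (c, x, h, 0) \<Phi> = \<Phi> \<longleftrightarrow> (\<forall>u. \<Phi> (h + u) = c * \<alpha> h u * x u * \<Phi> u)"
    for c x h
  proof
    assume *: "quad_act \<alpha> (c, x, h, 0) \<Phi> = \<Phi>"
    show "\<forall>u. \<Phi> (h + u) = c * \<alpha> h u * x u * \<Phi> u"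
    proof
      fix u
      have "quad_act \<alpha> (c, x, h, 0) \<Phi> (h + u) = \<Phi> (h + u)" by (simp only: *)
      thus "\<Phi> (h + u) = c * \<alpha> h u * x u * \<Phi> u"
        unfolding quad_act_eq by (simp add: mult_ac)
    qed
  next
    assume *: "\<forall>u. \<Phi> (h + u) = c * \<alpha> h u * x u * \<Phi> u"
    show "quad_act \<alpha> (c, x, h, 0) \<Phi> = \<Phi>"
    proof
      fix u
      show "quad_act \<alpha> (c, x, h, 0) \<Phi> u = \<Phi> u"
        unfolding quad_act_eq using *[rule_format, of "u - h"] by (simp add: mult_ac)
    qed
  qed
  ultimately show ?thesis
    by (simp add: theta_functions_def)
qed

end

section \<open>Absolute values and unconditional convergence\<close>

context absolute_value
begin

sublocale K: Metric_space UNIV "nrm_dist nrm"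
  by (rule Metric_space_nrm_dist)

lemma limitin_iff: "limitin K.mtopology f l F \<longleftrightarrow> ((\<lambda>x. nrm (f x - l)) \<longlongrightarrow> 0) F"
  unfolding K.limitin_metric_dist_null by (simp add: nrm_dist_def)

lemma limitin_mult_left:
  assumes "limitin K.mtopology f l F"
  shows "limitin K.mtopology (\<lambda>x. c * f x) (c * l) F"
proof -
  have "((\<lambda>x. nrm c * nrm (f x - l)) \<longlongrightarrow> nrm c * 0) F"
    by (intro tendsto_mult_left) (use assms in \<open>simp add: limitin_iff\<close>)
  thus ?thesis
    by (simp add: limitin_iff nrm_mult[symmetric] algebra_simps)
qed

lemma nrm_0 [simp]: "nrm 0 = 0"
  by (simp add: nrm_eq_0_iff)

lemma nrm_pos_iff: "nrm c > 0 \<longleftrightarrow> c \<noteq> 0"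
  using nrm_nonneg[of c] nrm_eq_0_iff[of c] by linarith

lemma nrm_sum: "nrm (sum f F) \<le> (\<Sum>p\<in>F. nrm (f p))"
  by (induction F rule: infinite_finite_induct) (auto intro: order_trans[OF nrm_triangle])

lemma nrm_minus_commute: "nrm (c - d) = nrm (d - c)"
  using K.commute[of c d] by (simp add: nrm_dist_def)

lemma ln_nrm_mult: "c \<noteq> 0 \<Longrightarrow> d \<noteq> 0 \<Longrightarrow> ln (nrm (c * d)) = ln (nrm c) + ln (nrm d)"
  by (simp add: nrm_mult ln_mult nrm_eq_0_iff)

text \<open>
  The finite partial sums form a Cauchy net, because their differences are dominated by tails of a
  convergent real sum.  Completeness is about sequences, so the limit is found along an increasing
  sequence of finite sets \<open>F k\<close> beyond which all tails are smaller than \<open>2 / (k + 1)\<close>.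
\<close>
lemma nrm_summable_imp_limit:
  assumes complete: "K.mcomplete" and sum: "(\<lambda>p. nrm (f p)) summable_on A"
  shows "\<exists>l. limitin K.mtopology (sum f) l (finite_subsets_at_top A)"
proof -
  define S where "S = infsum (\<lambda>p. nrm (f p)) A"
  have lim: "(sum (\<lambda>p. nrm (f p)) \<longlongrightarrow> S) (finite_subsets_at_top A)"
    unfolding S_def using has_sum_infsum[OF sum] by (simp add: has_sum_def)
  have "\<exists>F. finite F \<and> F \<subseteq> A \<and> (\<forall>G. finite G \<and> F \<subseteq> G \<and> G \<subseteq> A \<longrightarrow>
      dist (\<Sum>p\<in>G. nrm (f p)) S < inverse (real (Suc k)))" for k
    using tendstoD[OF lim, of "inverse (real (Suc k))"]
    by (simp add: eventually_finite_subsets_at_top)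
  then obtain F0 where F0: "\<And>k. finite (F0 k)" "\<And>k. F0 k \<subseteq> A"
      "\<And>k G. finite G \<Longrightarrow> F0 k \<subseteq> G \<Longrightarrow> G \<subseteq> A \<Longrightarrow>
         dist (\<Sum>p\<in>G. nrm (f p)) S < inverse (real (Suc k))"
    by metis
  define F where "F k = (\<Union>j\<le>k. F0 j)" for k
  have F: "finite (F k)" "F k \<subseteq> A" "F0 k \<subseteq> F k" for k
    using F0(1,2) by (auto simp: F_def)
  have mono: "F k \<subseteq> F l" if "k \<le> l" for k l
    unfolding F_def using that by (intro UN_mono) auto
  have tail: "nrm (sum f G - sum f (F k)) < 2 * inverse (real (Suc k))"
    if G: "finite G" "F k \<subseteq> G" "G \<subseteq> A" for G k
  proof -
    have "sum f G - sum f (F k) = sum f (G - F k)"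
      using G by (simp add: sum_diff)
    also have "nrm \<dots> \<le> (\<Sum>p\<in>G - F k. nrm (f p))" by (rule nrm_sum)
    also have "\<dots> = (\<Sum>p\<in>G. nrm (f p)) - (\<Sum>p\<in>F k. nrm (f p))"
      using G F(1) by (simp add: sum_diff)
    also have "\<dots> < 2 * inverse (real (Suc k))"
      using F0(3)[of G k] F0(3)[of "F k" k] F[of k] G order_trans[OF F(3)[of k] G(2)]
      by (simp add: dist_real_def)
    finally show ?thesis by simp
  qed
  have "K.MCauchy (\<lambda>k. sum f (F k))"
    unfolding K.MCauchy_def
  proof (intro conjI allI impI)
    fix \<epsilon> :: real assume "\<epsilon> > 0"
    then obtain N where N: "inverse (real (Suc N)) < \<epsilon> / 4"
      using reals_Archimedean[of "\<epsilon> / 4"] by auto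
    have "nrm_dist nrm (sum f (F k)) (sum f (F l)) < \<epsilon>" if "N \<le> k" "N \<le> l" for k l
    proof -
      have "nrm (sum f (F k) - sum f (F l))
          \<le> nrm (sum f (F k) - sum f (F N)) + nrm (sum f (F N) - sum f (F l))"
        using nrm_triangle[of "sum f (F k) - sum f (F N)" "sum f (F N) - sum f (F l)"] by simp
      also have "\<dots> < \<epsilon>"
        using tail[OF F(1) mono[OF that(1)] F(2)] tail[OF F(1) mono[OF that(2)] F(2)] N
        by (simp add: nrm_minus_commute[of "sum f (F N)"])
      finally show ?thesis by (simp add: nrm_dist_def)
    qed
    thus "\<exists>N. \<forall>k l. N \<le> k \<longrightarrow> N \<le> l \<longrightarrow> nrm_dist nrm (sum f (F k)) (sum f (F l)) < \<epsilon>"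
      by blast
  qed simp
  then obtain l where l: "limitin K.mtopology (\<lambda>k. sum f (F k)) l sequentially"
    using complete unfolding K.mcomplete_def by blast
  have "limitin K.mtopology (sum f) l (finite_subsets_at_top A)"
    unfolding K.limitin_metric
  proof (intro conjI allI impI)
    fix \<epsilon> :: real assume \<epsilon>: "\<epsilon> > 0"
    obtain N where N: "inverse (real (Suc N)) < \<epsilon> / 4"
      using reals_Archimedean[of "\<epsilon> / 4"] \<epsilon> by auto
    have "\<forall>\<^sub>F k in sequentially. nrm (sum f (F k) - l) < \<epsilon> / 2"
      by (rule order_tendstoD(2)[OF l[unfolded limitin_iff]]) (use \<epsilon> in simp)
    then obtain k where k: "k \<ge> N" "nrm (sum f (F k) - l) < \<epsilon> / 2"
      by (auto simp: eventually_sequentially) (meson nle_le)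
    have "nrm (sum f G - l) < \<epsilon>" if G: "finite G" "F k \<subseteq> G" "G \<subseteq> A" for G
    proof -
      have "nrm (sum f G - l) \<le> nrm (sum f G - sum f (F k)) + nrm (sum f (F k) - l)"
        using nrm_triangle[of "sum f G - sum f (F k)" "sum f (F k) - l"] by simp
      moreover have "inverse (real (Suc k)) \<le> inverse (real (Suc N))"
        using k(1) by (simp add: divide_simps)
      ultimately show ?thesis using tail[OF G] k(2) N by linarith
    qed
    thus "\<forall>\<^sub>F G in finite_subsets_at_top A. sum f G \<in> UNIV \<and> nrm_dist nrm (sum f G) l < \<epsilon>"
      unfolding eventually_finite_subsets_at_top nrm_dist_def
      by (intro exI[of _ "F k"]) (simp add: F)
  qed simp
  thus ?thesis ..
qed

end

section \<open>Composition of multipliers and products of theta functions\<close>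

locale composable_multipliers = skew_pairing \<alpha>
  for \<alpha> :: "'h::ab_group_add \<Rightarrow> 'h \<Rightarrow> 'k::field" +
  fixes L'' L' L :: "'b::ab_group_add \<Rightarrow> ('h, 'k) quadruple set"
  assumes multiplier'': "theta_multiplier \<alpha> L''"
    and multiplier': "theta_multiplier \<alpha> L'"
    and composable: "composable (L'' b) (L' b)"
    and L_eq: "L b = G_compose \<alpha> (L'' b) (L' b)"
begin

lemma carrier'': "L'' b \<in> carrier (G_grp \<alpha>)" and carrier': "L' b \<in> carrier (G_grp \<alpha>)"
  using multiplier'' multiplier' by (simp_all add: theta_multiplier_iff)

lemma left_rep_L:
  "L b \<in> carrier (G_grp \<alpha>)"
  "c_l (L b) = c_l (L'' b) * c_l (L' b) * \<alpha> (h_l (L' b)) (h_l (L'' b))"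
  "x_l (L b) = x_l (L'' b)"
  "h_l (L b) = h_l (L' b) + h_l (L'' b)"
  unfolding L_eq by (rule compose_left_rep[OF carrier'' carrier' composable])+

lemma x_l_eq: "x_l (L'' b) u = x_l (L' b) u * (\<alpha> u (h_l (L'' b)))\<^sup>2"
  using composable[of b] composable_iff[OF carrier''] by blast

lemma torus'': "x_l (L'' b) \<in> torus"
  by (rule left_rep_carrier(2)[OF carrier''])

text \<open>
  The structure form of \<open>L\<close> contains \<open>x''\<^sub>1(h'\<^sub>2) = x'\<^sub>1(h'\<^sub>2) \<alpha>(h'\<^sub>2, h''\<^sub>1)\<^sup>2\<close>; one of the two factors
  \<open>\<alpha>(h'\<^sub>2, h''\<^sub>1)\<close> cancels against \<open>\<alpha>(h''\<^sub>1, h'\<^sub>2)\<close>.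
\<close>
lemma structure_form_L:
  "structure_form \<alpha> L b1 b2 = structure_form \<alpha> L'' b1 b2 * structure_form \<alpha> L' b1 b2
     * \<alpha> (h_l (L' b2)) (h_l (L'' b1)) * \<alpha> (h_l (L' b1)) (h_l (L'' b2))"
proof -
  have "\<alpha> (h_l (L'' b1)) (h_l (L' b2)) = inverse (\<alpha> (h_l (L' b2)) (h_l (L'' b1)))" by (rule skew)
  thus ?thesis
    by (simp add: structure_form_def left_rep_L torusD(2)[OF torus''] x_l_eq[of b1 "h_l (L' b2)"]
          add_left add_right nonzero power2_eq_square field_simps)
qed

lemma multiplier_L: "theta_multiplier \<alpha> L"
  unfolding theta_multiplier_iff
proof (intro conjI allI)
  fix b1 b2
  have m'': "c_l (L'' (b1 + b2)) = c_l (L'' b1) * c_l (L'' b2) * structure_form \<alpha> L'' b1 b2"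
    "x_l (L'' (b1 + b2)) = (\<lambda>u. x_l (L'' b1) u * x_l (L'' b2) u)"
    "h_l (L'' (b1 + b2)) = h_l (L'' b1) + h_l (L'' b2)"
    using multiplier'' by (simp_all add: theta_multiplier_iff)
  have m': "c_l (L' (b1 + b2)) = c_l (L' b1) * c_l (L' b2) * structure_form \<alpha> L' b1 b2"
    "h_l (L' (b1 + b2)) = h_l (L' b1) + h_l (L' b2)"
    using multiplier' by (simp_all add: theta_multiplier_iff)
  show "c_l (L (b1 + b2)) = c_l (L b1) * c_l (L b2) * structure_form \<alpha> L b1 b2"
    unfolding structure_form_L left_rep_L m'' m' by (simp add: add_left add_right mult_ac)
  show "x_l (L (b1 + b2)) = (\<lambda>u. x_l (L b1) u * x_l (L b2) u)"
    by (simp add: left_rep_L m'')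
  show "h_l (L (b1 + b2)) = h_l (L b1) + h_l (L b2)"
    by (simp add: left_rep_L m'' m' add_ac)
qed (rule left_rep_L)

definition translate :: "'b \<Rightarrow> 'h \<times> 'h \<Rightarrow> 'h \<times> 'h" where
  "translate b = (\<lambda>(g, k). (h_l (L' b) + g, h_l (L'' b) + k))"

lemma inj_translate: "inj_on (translate b) A"
  by (auto simp: inj_on_def translate_def)

lemma translate_fibre:
  "translate b ` {p. fst p + snd p = u} = {p. fst p + snd p = h_l (L b) + u}"
proof (intro equalityI subsetI)
  fix p assume "p \<in> {p. fst p + snd p = h_l (L b) + u}"
  hence "(fst p - h_l (L' b), snd p - h_l (L'' b)) \<in> {p. fst p + snd p = u}"
    "p = translate b (fst p - h_l (L' b), snd p - h_l (L'' b))"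
    by (auto simp: translate_def left_rep_L algebra_simps)
  thus "p \<in> translate b ` {p. fst p + snd p = u}" by blast
qed (auto simp: translate_def left_rep_L algebra_simps)

text \<open>
  Of the factors that depend on \<open>g\<close> and \<open>k\<close> separately, \<open>x'(g) x''(k)\<close> equals
  \<open>x''(g + k) \<alpha>(g, h'')\<^sup>-\<^sup>2\<close>, and the surplus \<open>\<alpha>(g, h'')\<^sup>-\<^sup>2\<close> is what turns the remaining values of
  \<open>\<alpha>\<close> into \<open>\<alpha>(h' + h'', g + k)\<close>.
\<close>
lemma conv_term_translate:
  assumes "\<theta>' \<in> theta_functions \<alpha> L'" "\<theta>'' \<in> theta_functions \<alpha> L''" and u: "fst p + snd p = u"
  shows "conv_term \<alpha> \<theta>' \<theta>'' (translate b p) =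
    c_l (L b) * \<alpha> (h_l (L b)) u * x_l (L b) u * conv_term \<alpha> \<theta>' \<theta>'' p"
proof -
  obtain g k where p: "p = (g, k)" by force
  have t': "\<theta>' (h_l (L' b) + g) = c_l (L' b) * \<alpha> (h_l (L' b)) g * x_l (L' b) g * \<theta>' g"
    using assms(1) theta_functions_iff[OF multiplier'] by blast
  have t'': "\<theta>'' (h_l (L'' b) + k) = c_l (L'' b) * \<alpha> (h_l (L'' b)) k * x_l (L'' b) k * \<theta>'' k"
    using assms(2) theta_functions_iff[OF multiplier''] by blast
  have sk: "\<alpha> (h_l (L'' b)) g = inverse (\<alpha> g (h_l (L'' b)))" by (rule skew)
  show ?thesis
    unfolding conv_term_def translate_def p u[symmetric] prod.case fst_conv snd_conv t' t'' left_rep_L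
    by (simp add: torusD(2)[OF torus''] x_l_eq[of b g] sk add_left add_right nonzero
          power2_eq_square field_simps)
qed

text \<open>
  The factor in the previous lemma is nonzero, so the translation also respects the supports over
  which the finite sums are taken.
\<close>
lemma formal_product_theta:
  assumes "\<theta>' \<in> theta_functions \<alpha> L'" "\<theta>'' \<in> theta_functions \<alpha> L''"
    and "has_formal_product \<alpha> \<theta>' \<theta>'' \<theta>"
  shows "\<theta> \<in> theta_functions \<alpha> L"
  unfolding theta_functions_iff[OF multiplier_L]
proof (intro allI)
  fix b u
  define f where "f = conv_term \<alpha> \<theta>' \<theta>''"
  define C where "C = c_l (L b) * \<alpha> (h_l (L b)) u * x_l (L b) u"
  have C: "C \<noteq> 0"
    using left_rep_carrier[OF left_rep_L(1)[of b]] by (simp add: C_def nonzero torusD)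
  have f: "f (translate b p) = C * f p" if "fst p + snd p = u" for p
    using conv_term_translate[OF assms(1,2) that] by (simp add: f_def C_def)
  have theta: "\<theta> v = (\<Sum>p | fst p + snd p = v \<and> f p \<noteq> 0. f p)" for v
    using assms(3) by (simp add: has_formal_product_def formal_mult_def f_def)
  have "{p. fst p + snd p = h_l (L b) + u \<and> f p \<noteq> 0} =
      {p \<in> translate b ` {p. fst p + snd p = u}. f p \<noteq> 0}"
    by (simp add: translate_fibre)
  also have "\<dots> = translate b ` {p. fst p + snd p = u \<and> f p \<noteq> 0}"
    (is "?l = translate b ` ?r")
  proof (intro equalityI subsetI)
    fix p assume "p \<in> ?l"
    then obtain q where "fst q + snd q = u" "p = translate b q" "f p \<noteq> 0"
      by blast
    with f[of q] show "p \<in> translate b ` ?r" by (intro image_eqI[of _ _ q]) auto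
  next
    fix p assume "p \<in> translate b ` ?r"
    then obtain q where "fst q + snd q = u" "p = translate b q" "f q \<noteq> 0"
      by blast
    with f[of q] C show "p \<in> ?l" by auto
  qed
  finally have supp: "{p. fst p + snd p = h_l (L b) + u \<and> f p \<noteq> 0} = \<dots>" .
  have "\<theta> (h_l (L b) + u) = (\<Sum>p | fst p + snd p = u \<and> f p \<noteq> 0. C * f p)"
    unfolding theta supp sum.reindex[OF inj_translate] by (intro sum.cong) (auto simp: f)
  also have "\<dots> = C * \<theta> u"
    by (simp add: theta sum_distrib_left)
  finally show "\<theta> (h_l (L b) + u) = c_l (L b) * \<alpha> (h_l (L b)) u * x_l (L b) u * \<theta> u"
    by (simp add: C_def)
qed

text \<open>
  Translation identifies the nets of finite subsets of two fibres, so both sides of the functional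
  equation are limits of the same net, and limits in a metric space are unique.
\<close>
lemma nrm_product_theta:
  assumes "absolute_value nrm"
    and "\<theta>' \<in> theta_functions \<alpha> L'" "\<theta>'' \<in> theta_functions \<alpha> L''"
    and "has_nrm_product nrm \<alpha> \<theta>' \<theta>'' \<theta>"
  shows "\<theta> \<in> theta_functions \<alpha> L"
  unfolding theta_functions_iff[OF multiplier_L]
proof (intro allI)
  interpret absolute_value nrm by fact
  fix b u
  define f where "f = conv_term \<alpha> \<theta>' \<theta>''"
  define C where "C = c_l (L b) * \<alpha> (h_l (L b)) u * x_l (L b) u"
  define A where "A = (\<lambda>v::'h. {p. fst p + snd p = v})"
  have f: "f (translate b p) = C * f p" if "p \<in> A u" for p
    using conv_term_translate[OF assms(2,3), of p u b] that by (simp add: f_def C_def A_def)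
  have img: "A (h_l (L b) + u) = translate b ` A u"
    by (simp add: A_def translate_fibre)
  have lim: "limitin K.mtopology (sum f) (\<theta> v) (finite_subsets_at_top (A v))" for v
    using assms(4) by (simp add: has_nrm_product_def f_def A_def)
  have "limitin K.mtopology (\<lambda>F. sum f (translate b ` F)) (\<theta> (h_l (L b) + u))
          (finite_subsets_at_top (A u))"
    using lim[of "h_l (L b) + u"]
    unfolding img limitin_iff filtermap_image_finite_subsets_at_top[OF inj_translate, symmetric]
    by (simp add: filterlim_filtermap)
  moreover have "limitin K.mtopology (\<lambda>F. sum f (translate b ` F)) (C * \<theta> u)
      (finite_subsets_at_top (A u))"
  proof (rule limitin_transform_eventually[OF _ limitin_mult_left[OF lim]])
    have "C * sum f F = sum f (translate b ` F)" if "F \<subseteq> A u" for F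
      unfolding sum.reindex[OF inj_translate] sum_distrib_left
      using that by (intro sum.cong) (auto simp: f)
    thus "\<forall>\<^sub>F F in finite_subsets_at_top (A u). C * sum f F = sum f (translate b ` F)"
      by (auto intro: eventually_finite_subsets_at_top_weakI)
  qed
  ultimately have "\<theta> (h_l (L b) + u) = C * \<theta> u"
    by (rule K.limitin_metric_unique) simp
  thus "\<theta> (h_l (L b) + u) = c_l (L b) * \<alpha> (h_l (L b)) u * x_l (L b) u * \<theta> u"
    by (simp add: C_def)
qed

end

section \<open>Integral combinations and lattice bases\<close>

text \<open>
  The type class of abelian groups carries no scalar multiplication by integers.
\<close>
definition zmul :: "int \<Rightarrow> 'a::ab_group_add \<Rightarrow> 'a" where
  "zmul k a = a [^]\<^bsub>add_group\<^esub> k"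

lemma group_add_group: "group (add_group :: 'a::ab_group_add monoid)"
  by (rule comm_group.axioms(2)[OF comm_group_add_group])

lemma additive_iff_hom: "Modules.additive f \<longleftrightarrow> f \<in> hom add_group add_group"
  by (auto simp: Modules.additive_def hom_def add_group_def)

lemma additive_zmul: "Modules.additive f \<Longrightarrow> f (zmul k a) = zmul k (f a)"
  unfolding zmul_def additive_iff_hom
  by (rule hom_int_pow[OF _ _ group_add_group group_add_group]) (simp_all add: add_group_def)

lemma zmul_add_left: "zmul (k + l) a = zmul k a + zmul l a"
  using group.int_pow_mult[OF group_add_group, of a k l] by (simp add: zmul_def add_group_def)

lemma zmul_zmul: "zmul k (zmul l a) = zmul (k * l) a"
  using group.int_pow_pow[OF group_add_group, of a l k]
  by (simp add: zmul_def add_group_def mult.commute)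

lemma zmul_0_left [simp]: "zmul 0 a = 0"
  by (simp add: zmul_def add_group_def)

lemma zmul_1_left [simp]: "zmul 1 a = a"
  using group.int_pow_1[OF group_add_group, of a] by (simp add: zmul_def add_group_def)

lemma zmul_diff_left: "zmul (k - l) a = zmul k a - zmul l a"
  using zmul_add_left[of "k - l" l a] by simp

text \<open>
  Integer multiples are determined by additivity; this identifies them with products in \<open>\<int>\<close> and
  \<open>\<real>\<close>.
\<close>
lemma zmul_eqI:
  assumes "Modules.additive F" "F 1 = a"
  shows "zmul k a = F k"
proof (induction k rule: int_induct[where k = 0])
  case base
  show ?case by (simp add: Modules.additive.zero[OF assms(1)])
next
  case (step1 i)
  thus ?case by (simp add: zmul_add_left Modules.additive.add[OF assms(1)] assms(2))
next
  case (step2 i)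
  thus ?case by (simp add: zmul_diff_left Modules.additive.diff[OF assms(1)] assms(2))
qed

lemma zmul_int [simp]: "zmul k (m::int) = k * m"
  by (rule zmul_eqI) (simp_all add: Modules.additive_def algebra_simps)

lemma zmul_real [simp]: "zmul k (r::real) = of_int k * r"
  by (rule zmul_eqI) (simp_all add: Modules.additive_def algebra_simps)

definition zcomb :: "nat \<Rightarrow> (nat \<Rightarrow> int) \<Rightarrow> (nat \<Rightarrow> 'a::ab_group_add) \<Rightarrow> 'a" where
  "zcomb n m v = (\<Sum>i<n. zmul (m i) (v i))"

lemma additive_zcomb: "Modules.additive f \<Longrightarrow> f (zcomb n m v) = zcomb n m (\<lambda>i. f (v i))"
  by (simp add: zcomb_def Modules.additive.sum additive_zmul)

lemma zcomb_diff: "zcomb n (\<lambda>i. m i - m' i) v = zcomb n m v - zcomb n m' v"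
  by (simp add: zcomb_def zmul_diff_left sum_subtractf)

lemma zcomb_add: "zcomb n (\<lambda>i. m i + m' i) v = zcomb n m v + zcomb n m' v"
  by (simp add: zcomb_def zmul_add_left sum.distrib)

lemma zcomb_real: "zcomb n m (v :: nat \<Rightarrow> real) = (\<Sum>i<n. of_int (m i) * v i)"
  by (simp add: zcomb_def)

lemma zcomb_delta:
  assumes "i < n" "\<And>j. j < n \<Longrightarrow> a j = (if i = j then 1 else 0)"
  shows "zcomb n m a = (m i :: int)"
proof -
  have "zcomb n m a = (\<Sum>j<n. if i = j then m j else 0)"
    unfolding zcomb_def by (rule sum.cong) (simp_all add: assms)
  thus ?thesis using assms(1) by simp
qed

lemma zcomb_zmul: "zcomb n m (\<lambda>i. zmul (N i) (v i)) = zcomb n (\<lambda>i. m i * N i) v"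
  by (simp add: zcomb_def zmul_zmul)

text \<open>
  Both families are total functions on the natural numbers, standing for lists of length \<open>n\<close>: a
  basis and its coordinate functions.
\<close>
locale lattice_basis =
  fixes n :: nat and e :: "nat \<Rightarrow> 'h::ab_group_add" and crd :: "nat \<Rightarrow> 'h \<Rightarrow> int"
  assumes additive_crd: "Modules.additive (crd i)"
    and expansion: "zcomb n (\<lambda>i. crd i h) e = h"
    and crd_basis: "i < n \<Longrightarrow> j < n \<Longrightarrow> crd i (e j) = (if i = j then 1 else 0)"
begin

lemma crd_zcomb: "i < n \<Longrightarrow> crd i (zcomb n m e) = m i"
  unfolding additive_zcomb[OF additive_crd] by (rule zcomb_delta) (auto simp: crd_basis)

end

lemma exists_lattice_basis:
  assumes "free_abelian_finite_rank TYPE('h::ab_group_add)"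
  obtains n and e :: "nat \<Rightarrow> 'h::ab_group_add" and crd where "lattice_basis n e crd"
proof -
  obtain n where "(add_group :: 'h monoid) \<cong> free_Abelian_group {..<n::nat}"
    using assms by (auto simp: free_abelian_finite_rank_def)
  then obtain \<phi> where \<phi>: "\<phi> \<in> iso (add_group :: 'h monoid) (free_Abelian_group {..<n})"
    by (auto simp: is_iso_def)
  have add: "\<phi> (a + b) = \<phi> a + \<phi> b" for a b
    using \<phi> by (auto simp: iso_def hom_def add_group_def)
  have bij: "bij_betw \<phi> UNIV {c. Poly_Mapping.keys c \<subseteq> {..<n}}"
    using \<phi> by (simp add: iso_def add_group_def free_Abelian_group_def)
  define e where "e i = inv_into UNIV \<phi> (frag_of i)" for i
  have \<phi>_e: "\<phi> (e i) = frag_of i" if "i < n" for i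
    unfolding e_def using that bij by (intro f_inv_into_f) (auto simp: bij_betw_def)
  define crd where "crd i h = Poly_Mapping.lookup (\<phi> h) i" for i h
  have crd: "Modules.additive (crd i)" for i
    by (simp add: Modules.additive_def crd_def add lookup_add)
  have "lattice_basis n e crd"
  proof
    show "crd i (x + y) = crd i x + crd i y" for i x y
      using crd by (simp add: Modules.additive_def)
    show basis: "crd i (e j) = (if i = j then 1 else 0)" if "i < n" "j < n" for i j
      using that by (simp add: crd_def \<phi>_e)
    fix h
    have "\<phi> (zcomb n (\<lambda>i. crd i h) e) = \<phi> h"
    proof (rule poly_mapping_eqI)
      fix i
      have keys: "Poly_Mapping.keys (\<phi> h) \<subseteq> {..<n}" for h
        using bij by (auto simp: bij_betw_def)
      show "Poly_Mapping.lookup (\<phi> (zcomb n (\<lambda>i. crd i h) e)) i = Poly_Mapping.lookup (\<phi> h) i"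
      proof (cases "i < n")
        case True
        have "crd i (zcomb n (\<lambda>i. crd i h) e) = crd i h"
          unfolding additive_zcomb[OF crd] by (rule zcomb_delta[OF True]) (simp add: basis True)
        thus ?thesis by (simp add: crd_def)
      next
        case False
        hence "i \<notin> Poly_Mapping.keys (\<phi> h)" for h using keys[of h] by auto
        thus ?thesis by (simp add: in_keys_iff)
      qed
    qed
    thus "zcomb n (\<lambda>i. crd i h) e = h"
      using bij by (auto simp: bij_betw_def inj_eq)
  qed
  thus thesis by (rule that)
qed

context lattice_basis
begin

text \<open>
  Linearly independent \<open>v 0, \<dots>, v (n - 1)\<close> generate a subgroup of finite index, by counting.  If the
  elements of \<open>F\<close> are pairwise incongruent, the points \<open>f + \<Sum>\<^sub>i m\<^sub>i v\<^sub>i\<close> with \<open>0 \<le> m\<^sub>i < R\<close> are pairwise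
  distinct and lie in a cube whose side is linear in \<open>R\<close>.  Comparing the numbers of points, of order
  \<open>R\<^sup>n\<close> on both sides, bounds the size of \<open>F\<close> by a constant that depends on the \<open>v\<^sub>i\<close> only.
\<close>
lemma card_incongruent_le:
  fixes v :: "nat \<Rightarrow> 'h"
  assumes indep: "\<And>m. zcomb n m v = 0 \<Longrightarrow> (\<forall>i<n. m i = 0)"
  obtains b :: nat where "\<And>F. finite F \<Longrightarrow> (\<And>f g m. f \<in> F \<Longrightarrow> g \<in> F \<Longrightarrow> f - g = zcomb n m v \<Longrightarrow> f = g)
     \<Longrightarrow> card F \<le> b"
proof -
  define C where "C = (\<Sum>i<n. \<Sum>j<n. \<bar>crd i (v j)\<bar>)"
  have C0: "C \<ge> 0" by (simp add: C_def sum_nonneg)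
  have "card F \<le> nat (2 * C + 3) ^ n"
    if fin: "finite F"
      and incong: "\<And>f g m. f \<in> F \<Longrightarrow> g \<in> F \<Longrightarrow> f - g = zcomb n m v \<Longrightarrow> f = g" for F
  proof -
    define D where "D = (\<Sum>f\<in>F. \<Sum>i<n. \<bar>crd i f\<bar>)"
    \<comment> \<open>The cube has to be at least as large as \<open>F\<close>: then a side length of \<open>2 S + 1\<close> is at most
      \<open>(2 C + 3) R\<close>, and the powers of \<open>R\<close> cancel.\<close>
    define R where "R = D + 1"
    define S where "S = C * R + R"
    have D: "\<bar>crd i f\<bar> \<le> D" if "f \<in> F" "i < n" for f i
    proof -
      have "\<bar>crd i f\<bar> \<le> (\<Sum>i<n. \<bar>crd i f\<bar>)"
        using that(2) by (intro member_le_sum) auto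
      also have "\<dots> \<le> D"
        unfolding D_def using that(1) fin by (intro member_le_sum) (auto intro: sum_nonneg)
      finally show ?thesis by simp
    qed
    have R: "R \<ge> 1" by (simp add: R_def D_def sum_nonneg)
    have S0: "S \<ge> 0" using R C0 by (simp add: S_def)
    define cube where "cube = ({..<n} \<rightarrow>\<^sub>E {0..<R})"
    define box where "box = ({..<n} \<rightarrow>\<^sub>E {-S..S})"
    define t where "t = (\<lambda>(f, m). \<lambda>i\<in>{..<n}. crd i (f + zcomb n m v))"
    have "inj_on t (F \<times> cube)"
    proof (rule inj_onI, clarify)
      fix f m g m' assume *: "f \<in> F" "g \<in> F" "m \<in> cube" "m' \<in> cube" "t (f, m) = t (g, m')"
      have "crd i (f + zcomb n m v) = crd i (g + zcomb n m' v)" if "i < n" for i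
        using fun_cong[OF *(5), of i] that by (simp add: t_def)
      hence "zcomb n (\<lambda>i. crd i (f + zcomb n m v)) e = zcomb n (\<lambda>i. crd i (g + zcomb n m' v)) e"
        by (simp add: zcomb_def)
      hence eq: "f + zcomb n m v = g + zcomb n m' v"
        by (simp only: expansion)
      hence "f - g = zcomb n (\<lambda>i. m' i - m i) v"
        by (simp add: zcomb_diff algebra_simps)
      hence fg: "f = g" using incong *(1,2) by blast
      hence "zcomb n (\<lambda>i. m' i - m i) v = 0"
        using eq by (simp add: zcomb_diff)
      hence "\<forall>i<n. m i = m' i" using indep by fastforce
      hence "m = m'" using *(3,4) unfolding cube_def by (intro PiE_ext) auto
      with fg show "f = g \<and> m = m'" by simp
    qed
    moreover have "t ` (F \<times> cube) \<subseteq> box"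
    proof clarify
      fix f m assume *: "f \<in> F" "m \<in> cube"
      have m: "\<bar>m j\<bar> \<le> R" if "j \<in> {..<n}" for j
        using PiE_mem[OF *(2)[unfolded cube_def] that] by simp
      have "\<bar>crd i (f + zcomb n m v)\<bar> \<le> S" if "i < n" for i
      proof -
        have "crd i (f + zcomb n m v) = crd i f + (\<Sum>j<n. m j * crd i (v j))"
          by (simp add: Modules.additive.add[OF additive_crd] additive_zcomb[OF additive_crd])
             (simp add: zcomb_def)
        also have "\<bar>\<dots>\<bar> \<le> \<bar>crd i f\<bar> + (\<Sum>j<n. \<bar>m j * crd i (v j)\<bar>)"
          by (rule order_trans[OF abs_triangle_ineq add_left_mono[OF sum_abs]])
        also have "(\<Sum>j<n. \<bar>m j * crd i (v j)\<bar>) \<le> (\<Sum>j<n. R * \<bar>crd i (v j)\<bar>)"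
          unfolding abs_mult by (intro sum_mono mult_right_mono m) auto
        also have "\<dots> = R * (\<Sum>j<n. \<bar>crd i (v j)\<bar>)" by (simp add: sum_distrib_left)
        also have "(\<Sum>j<n. \<bar>crd i (v j)\<bar>) \<le> C"
          unfolding C_def using that by (intro member_le_sum) (auto intro: sum_nonneg)
        also have "\<bar>crd i f\<bar> + R * C \<le> S"
          using D[OF *(1) that] by (simp add: S_def R_def algebra_simps)
        finally show ?thesis using R by simp
      qed
      hence "crd i (f + zcomb n m v) \<in> {-S..S}" if "i < n" for i
        using that by (auto simp: abs_le_iff minus_le_iff)
      thus "t (f, m) \<in> box"
        by (simp add: t_def box_def restrict_PiE_iff)
    qed
    moreover have "finite box"
      unfolding box_def by (intro finite_PiE) auto
    ultimately have "card (F \<times> cube) \<le> card box"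
      by (intro card_inj_on_le)
    hence "card F * nat R ^ n \<le> nat (2 * S + 1) ^ n"
      using S0 by (simp add: cube_def box_def card_cartesian_product card_PiE)
    also have "\<dots> \<le> (nat (2 * C + 3) * nat R) ^ n"
    proof (rule power_mono)
      have "2 * S + 1 \<le> (2 * C + 3) * R"
        using R by (simp add: S_def algebra_simps)
      thus "nat (2 * S + 1) \<le> nat (2 * C + 3) * nat R"
        using R C0 by (simp add: nat_mult_distrib[symmetric])
    qed simp
    finally show ?thesis
      using R by (simp add: power_mult_distrib)
  qed
  thus thesis by (rule that)
qed

end

section \<open>Subgroups of finite index in a lattice\<close>

lemma rcosets_add_group: "rcosets\<^bsub>add_group\<^esub> S = range (\<lambda>a. (\<lambda>s. s + a) ` S)"
  by (auto simp: RCOSETS_def r_coset_def add_group_def)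

text \<open>
  Two of the infinitely many multiples of \<open>a\<close> lie in the same coset.
\<close>
lemma multiple_in_finite_index_range:
  assumes "Modules.additive f" "finite (rcosets\<^bsub>add_group\<^esub> (range f))"
  obtains N b where "N > 0" "f b = zmul N a"
proof -
  have "\<not> inj (\<lambda>k::nat. (\<lambda>s. s + zmul (int k) a) ` range f)"
  proof
    assume "inj (\<lambda>k::nat. (\<lambda>s. s + zmul (int k) a) ` range f)"
    moreover have "range (\<lambda>k::nat. (\<lambda>s. s + zmul (int k) a) ` range f) \<subseteq> rcosets\<^bsub>add_group\<^esub> (range f)"
      unfolding rcosets_add_group by blast
    ultimately show False
      using assms(2) finite_subset finite_imageD infinite_UNIV_nat by blast
  qed
  then obtain k l where kl: "k < l" and
    eq: "(\<lambda>s. s + zmul (int k) a) ` range f = (\<lambda>s. s + zmul (int l) a) ` range f"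
    unfolding inj_def by (metis linorder_neqE_nat)
  have "f 0 + zmul (int l) a \<in> (\<lambda>s. s + zmul (int l) a) ` range f" by blast
  then obtain b where "f 0 + zmul (int l) a = f b + zmul (int k) a"
    unfolding eq[symmetric] by blast
  hence "f b = zmul (int l - int k) a"
    by (simp add: Modules.additive.zero[OF assms(1)] zmul_diff_left algebra_simps)
  thus thesis using that[of "int l - int k" b] kl by simp
qed

context lattice_basis
begin

text \<open>
  The first embedding \<open>f\<close> only serves to show that \<open>B\<close> has full rank \<open>n\<close>: it contains \<open>n\<close>
  independent elements \<open>w i\<close>, mapped to multiples of the basis of \<open>H\<close>.  Their images under \<open>g\<close> are
  again independent and generate a subgroup of finite index.
\<close>
lemma finite_index_range:
  fixes f g :: "'b::ab_group_add \<Rightarrow> 'h"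
  assumes g: "Modules.additive g" "\<And>b. g b = 0 \<Longrightarrow> b = 0"
    and f: "Modules.additive f" "finite (rcosets\<^bsub>add_group\<^esub> (range f))"
  shows "finite (rcosets\<^bsub>add_group\<^esub> (range g))"
proof (rule ccontr)
  have "\<forall>i. \<exists>N b. N > 0 \<and> f b = zmul N (e i)"
    using multiple_in_finite_index_range[OF f] by metis
  then obtain N w where w: "\<And>i. N i > 0" "\<And>i. f (w i) = zmul (N i) (e i)"
    by metis
  have g_comb: "zcomb n m (\<lambda>i. g (w i)) = g (zcomb n m w)" for m
    by (rule additive_zcomb[OF g(1), symmetric])
  have "\<forall>i<n. m i = 0" if "zcomb n m (\<lambda>i. g (w i)) = 0" for m
  proof (intro allI impI)
    fix i assume "i < n"
    have "zcomb n m w = 0" using that g(2) by (simp add: g_comb)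
    hence "zcomb n m (\<lambda>i. f (w i)) = 0"
      using additive_zcomb[OF f(1), of n m w] Modules.additive.zero[OF f(1)] by simp
    hence "zcomb n (\<lambda>i. m i * N i) e = 0"
      by (simp add: w zcomb_zmul)
    hence "m i * N i = crd i 0" using crd_zcomb[OF \<open>i < n\<close>, of "\<lambda>i. m i * N i"] by simp
    thus "m i = 0" using w(1)[of i] by (simp add: Modules.additive.zero[OF additive_crd])
  qed
  from card_incongruent_le[of "\<lambda>i. g (w i)", OF this] obtain b where
    b: "\<And>F. finite F \<Longrightarrow>
      (\<And>x y m. x \<in> F \<Longrightarrow> y \<in> F \<Longrightarrow> x - y = zcomb n m (\<lambda>i. g (w i)) \<Longrightarrow> x = y) \<Longrightarrow> card F \<le> b"
    by metis
  assume "infinite (rcosets\<^bsub>add_group\<^esub> (range g))"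
  then obtain C where C: "finite C" "card C = Suc b" "C \<subseteq> rcosets\<^bsub>add_group\<^esub> (range g)"
    using infinite_arbitrarily_large by metis
  obtain F where F: "finite F" "inj_on (\<lambda>a. (\<lambda>s. s + a) ` range g) F" "C = (\<lambda>a. (\<lambda>s. s + a) ` range g) ` F"
  proof -
    have "\<exists>F. F \<subseteq> UNIV \<and> inj_on (\<lambda>a. (\<lambda>s. s + a) ` range g) F \<and> C = (\<lambda>a. (\<lambda>s. s + a) ` range g) ` F"
      using C(3) unfolding rcosets_add_group by (simp add: subset_image_inj)
    thus thesis using that C(1) finite_imageD by metis
  qed
  have "card F \<le> b"
  proof (rule b[OF F(1)])
    fix x y m assume xy: "x \<in> F" "y \<in> F" "x - y = zcomb n m (\<lambda>i. g (w i))"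
    define d where "d = zcomb n m w"
    have x: "x = g d + y" using xy(3) by (simp add: g_comb d_def algebra_simps)
    have *: "g b' + x = g (b' + d) + y" "g b' + y = g (b' - d) + x" for b'
      by (simp_all add: x Modules.additive.add[OF g(1)] Modules.additive.diff[OF g(1)])
    have "(\<lambda>s. s + x) ` range g = (\<lambda>s. s + y) ` range g"
      unfolding image_image
    proof (intro equalityI image_subsetI)
      fix b'
      show "g b' + x \<in> range (\<lambda>b. g b + y)"
        by (rule image_eqI[of _ _ "b' + d"]) (simp_all only: *(1) UNIV_I)
      show "g b' + y \<in> range (\<lambda>b. g b + x)"
        by (rule image_eqI[of _ _ "b' - d"]) (simp_all only: *(2) UNIV_I)
    qed
    thus "x = y" using F(2) xy(1,2) by (auto dest: inj_onD)
  qed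
  moreover have "card F = card C"
    using F by (simp add: card_image)
  ultimately show False using C(2) by simp
qed

end

section \<open>Negative definite forms and Gaussian decay\<close>

text \<open>
  An additive function on \<open>B\<close> extends to a linear functional on \<open>B \<otimes> \<real>\<close>.  Such functionals detect
  that an element of the tensor product is nonzero.
\<close>
lemma tensor_relations_functional:
  assumes "Modules.additive (\<phi> :: 'b::ab_group_add \<Rightarrow> real)" "r \<in> tensor_relations"
  shows "(\<Sum>b\<in>Poly_Mapping.keys r. Poly_Mapping.lookup r b * \<phi> b) = 0"
proof -
  define E where "E r = (\<Sum>b\<in>Poly_Mapping.keys r. Poly_Mapping.lookup r b * \<phi> b)" for r
  have E: "E r = (\<Sum>b\<in>A. Poly_Mapping.lookup r b * \<phi> b)"
    if "finite A" "Poly_Mapping.keys r \<subseteq> A" for r A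
    unfolding E_def using that by (intro sum.mono_neutral_left) (auto simp: in_keys_iff)
  have add: "E (r + s) = E r + E s" for r s
  proof -
    let ?A = "Poly_Mapping.keys r \<union> Poly_Mapping.keys s"
    have "E (r + s) = (\<Sum>b\<in>?A. Poly_Mapping.lookup (r + s) b * \<phi> b)"
      by (rule E) (simp_all add: keys_add)
    also have "\<dots> = E r + E s"
      by (simp add: E[of ?A r] E[of ?A s] lookup_add algebra_simps sum.distrib)
    finally show ?thesis .
  qed
  have diff: "E (r - s) = E r - E s" for r s
    using add[of "r - s" s] by simp
  have single: "E (Poly_Mapping.single b t) = t * \<phi> b" for b t
    by (simp add: E_def)
  have "E r = 0"
    using assms(2)
  proof (induction rule: tensor_relations.induct)
    case (step r b b' t)
    thus ?case by (simp only: add diff single Modules.additive.add[OF assms(1)]) (simp add: algebra_simps)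
  qed (simp add: E_def)
  thus ?thesis by (simp add: E_def)
qed

text \<open>
  Functionals dual to \<open>w 0, \<dots>, w (n - 1)\<close> make these elements linearly independent in \<open>B \<otimes> \<real>\<close>, so
  that definiteness applies to their nontrivial real combinations.
\<close>
lemma negative_definite_combination:
  fixes \<beta> :: "'b::ab_group_add \<Rightarrow> 'b \<Rightarrow> real" and n :: nat
  assumes neg: "negative_definite \<beta>"
    and add: "\<And>i. i < n \<Longrightarrow> Modules.additive (\<phi> i :: 'b \<Rightarrow> real)"
    and dual: "\<And>i j. i < n \<Longrightarrow> j < n \<Longrightarrow> \<phi> i (w j) = 0 \<longleftrightarrow> i \<noteq> j"
    and t: "\<exists>i<n. t i \<noteq> 0"
  shows "(\<Sum>i<n. \<Sum>j<n. t i * t j * \<beta> (w i) (w j)) < 0"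
proof -
  have inj: "inj_on w {..<n}"
    by (rule inj_onI) (metis dual lessThan_iff)
  define r where "r = (\<Sum>i<n. Poly_Mapping.single (w i) (t i))"
  have lookup_r: "Poly_Mapping.lookup r (w i) = t i" if "i < n" for i
  proof -
    have "Poly_Mapping.lookup r (w i) = (\<Sum>j<n. if i = j then t j else 0)"
      unfolding r_def lookup_sum
      by (rule sum.cong) (use that inj in \<open>auto simp: lookup_single when_def inj_on_def\<close>)
    thus ?thesis using that by simp
  qed
  have keys_r: "Poly_Mapping.keys r \<subseteq> w ` {..<n}"
  proof
    fix b assume "b \<in> Poly_Mapping.keys r"
    show "b \<in> w ` {..<n}"
    proof (rule ccontr)
      assume "b \<notin> w ` {..<n}"
      hence "Poly_Mapping.lookup r b = 0"
        unfolding r_def lookup_sum by (intro sum.neutral) (auto simp: lookup_single when_def)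
      with \<open>b \<in> Poly_Mapping.keys r\<close> show False by (simp add: in_keys_iff)
    qed
  qed
  have sum_keys: "(\<Sum>b\<in>Poly_Mapping.keys r. Poly_Mapping.lookup r b * F b) = (\<Sum>i<n. t i * F (w i))"
    for F :: "'b \<Rightarrow> real"
  proof -
    have "(\<Sum>b\<in>Poly_Mapping.keys r. Poly_Mapping.lookup r b * F b)
        = (\<Sum>b\<in>w ` {..<n}. Poly_Mapping.lookup r b * F b)"
      using keys_r by (intro sum.mono_neutral_left) (auto simp: in_keys_iff)
    thus ?thesis by (simp add: sum.reindex[OF inj] lookup_r)
  qed
  obtain k where k: "k < n" "t k \<noteq> 0" using t by blast
  have "(\<Sum>i<n. t i * \<phi> k (w i)) = (\<Sum>i<n. if i = k then t i * \<phi> k (w i) else 0)"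
    using k dual by (intro sum.cong) auto
  also have "\<dots> = t k * \<phi> k (w k)" using k by simp
  finally have "(\<Sum>b\<in>Poly_Mapping.keys r. Poly_Mapping.lookup r b * \<phi> k b) \<noteq> 0"
    using k dual[of k k] by (simp add: sum_keys)
  hence "r \<notin> tensor_relations"
    using tensor_relations_functional[OF add[OF k(1)]] by blast
  hence "(\<Sum>b\<in>Poly_Mapping.keys r. \<Sum>b'\<in>Poly_Mapping.keys r.
           Poly_Mapping.lookup r b * Poly_Mapping.lookup r b' * \<beta> b b') < 0"
    using neg by (simp add: negative_definite_def)
  thus ?thesis
    by (simp add: mult.assoc sum_distrib_left[symmetric] sum_keys)
qed

text \<open>
  For \<open>n > 0\<close> the form attains a maximum on the unit sphere, and \<open>-\<epsilon>\<close> is this maximum.  The sphere is viewed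
  inside the product space of all real sequences, where it is a closed subset of the compact cube
  \<open>[-1, 1]\<^sup>\<nat>\<close>.
\<close>
lemma negative_form_bound:
  fixes M :: "nat \<Rightarrow> nat \<Rightarrow> real"
  assumes neg: "\<And>t. \<exists>i<n. t i \<noteq> 0 \<Longrightarrow> (\<Sum>i<n. \<Sum>j<n. t i * t j * M i j) < 0"
  obtains \<epsilon> where "\<epsilon> > 0" "\<And>t. (\<Sum>i<n. \<Sum>j<n. t i * t j * M i j) \<le> - \<epsilon> * (\<Sum>i<n. (t i)\<^sup>2)"
proof -
  define Q where "Q t = (\<Sum>i<n. \<Sum>j<n. t i * t j * M i j)" for t
  define S where "S = {t :: nat \<Rightarrow> real. (\<forall>i\<in>{n..}. t i = 0) \<and> (\<Sum>i<n. (t i)\<^sup>2) = 1}"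
  have "compactin (product_topology (\<lambda>_. euclidean) UNIV) (PiE UNIV (\<lambda>_::nat. {-1..1::real}))"
    by (subst compactin_PiE) simp
  hence "compact (PiE UNIV (\<lambda>_::nat. {-1..1::real}))"
    by (simp add: euclidean_product_topology)
  moreover have "closed S"
  proof -
    have "S = (\<Inter>i\<in>{n..}. {t. t i = 0}) \<inter> {t. (\<Sum>i<n. (t i)\<^sup>2) = 1}"
      by (auto simp: S_def)
    also have "closed \<dots>"
      by (intro closed_Int closed_INT ballI closed_Collect_eq continuous_intros
            continuous_on_product_coordinates)
    finally show ?thesis .
  qed
  moreover have "S \<subseteq> PiE UNIV (\<lambda>_::nat. {-1..1::real})"
  proof
    fix t assume t: "t \<in> S"
    have "\<bar>t i\<bar> \<le> 1" for i
    proof (cases "i < n")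
      case True
      hence "(t i)\<^sup>2 \<le> (\<Sum>i<n. (t i)\<^sup>2)" by (intro member_le_sum) auto
      thus ?thesis using t by (simp add: S_def abs_square_le_1)
    qed (use t in \<open>simp add: S_def\<close>)
    thus "t \<in> PiE UNIV (\<lambda>_::nat. {-1..1::real})"
      by (auto simp: abs_le_iff minus_le_iff)
  qed
  ultimately have "compact S"
    using compact_Int_closed[of "PiE UNIV (\<lambda>_::nat. {-1..1::real})" S] by (simp add: Int_absorb1)
  have cont: "continuous_on S Q"
    unfolding Q_def
    by (intro continuous_intros continuous_on_subset[OF continuous_on_product_coordinates subset_UNIV])
  have "\<exists>\<epsilon>>0. \<forall>t\<in>S. Q t \<le> - \<epsilon>"
  proof (cases "S = {}")
    case False
    then obtain t where t: "t \<in> S" "\<forall>s\<in>S. Q s \<le> Q t"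
      using continuous_attains_sup[OF \<open>compact S\<close> _ cont] by blast
    have "\<exists>i<n. t i \<noteq> 0"
    proof (rule ccontr)
      assume "\<not> (\<exists>i<n. t i \<noteq> 0)"
      hence "(\<Sum>i<n. (t i)\<^sup>2) = 0" by simp
      with t(1) show False by (simp add: S_def)
    qed
    from neg[OF this] have "- Q t > 0" by (simp add: Q_def)
    thus ?thesis using t(2) by (intro exI[of _ "- Q t"]) auto
  qed (auto intro: exI[of _ 1])
  then obtain \<epsilon> where \<epsilon>: "\<epsilon> > 0" "\<And>t. t \<in> S \<Longrightarrow> Q t \<le> - \<epsilon>" by blast
  have "Q t \<le> - \<epsilon> * (\<Sum>i<n. (t i)\<^sup>2)" for t
  proof (cases "\<exists>i<n. t i \<noteq> 0")
    case True
    define \<rho> where "\<rho> = (\<Sum>i<n. (t i)\<^sup>2)"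
    obtain k where "k < n" "t k \<noteq> 0" using True by blast
    hence \<rho>: "\<rho> > 0" unfolding \<rho>_def by (intro sum_pos2[of _ k]) auto
    define s where "s = (\<lambda>i. if i < n then t i / sqrt \<rho> else 0)"
    have "(\<Sum>i<n. (s i)\<^sup>2) = (\<Sum>i<n. (t i)\<^sup>2 / \<rho>)"
      using \<rho> by (intro sum.cong) (auto simp: s_def power_divide)
    also have "\<dots> = 1" using \<rho> by (simp add: sum_divide_distrib[symmetric] \<rho>_def)
    finally have "s \<in> S" by (simp add: S_def s_def)
    have "Q t = \<rho> * Q s"
    proof -
      have st: "t i * t j = \<rho> * (s i * s j)" if "i < n" "j < n" for i j
        using \<rho> that by (simp add: s_def)
      show ?thesis
        unfolding Q_def sum_distrib_left
        by (intro sum.cong) (auto simp: st mult.assoc)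
    qed
    also have "\<dots> \<le> \<rho> * (- \<epsilon>)"
      using \<rho> \<epsilon>(2)[OF \<open>s \<in> S\<close>] by (intro mult_left_mono) auto
    finally show ?thesis by (simp add: \<rho>_def mult.commute)
  qed (simp add: Q_def)
  with \<epsilon>(1) show thesis by (intro that[of \<epsilon>]) (simp_all add: Q_def)
qed

text \<open>Completing the square.\<close>
lemma quadratic_beats_linear:
  fixes \<epsilon> l :: real
  assumes "\<epsilon> > 0"
  shows "- \<epsilon> * x\<^sup>2 + l * x \<le> (\<bar>l\<bar> + 1)\<^sup>2 / (4 * \<epsilon>) - \<bar>x\<bar>"
proof -
  define c where "c = \<bar>l\<bar> + 1"
  have "0 \<le> \<epsilon> * (\<bar>x\<bar> - c / (2 * \<epsilon>))\<^sup>2" using assms by simp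
  also have "\<dots> = \<epsilon> * x\<^sup>2 - c * \<bar>x\<bar> + c\<^sup>2 / (4 * \<epsilon>)"
    using assms by (simp add: power2_eq_square field_simps)
  finally have "- \<epsilon> * x\<^sup>2 + c * \<bar>x\<bar> \<le> c\<^sup>2 / (4 * \<epsilon>)" by simp
  moreover have "l * x \<le> \<bar>l\<bar> * \<bar>x\<bar>" by (metis abs_ge_self abs_mult)
  ultimately show ?thesis by (simp add: c_def algebra_simps)
qed

lemma sum_exp_abs_int_le:
  fixes \<delta> :: real
  assumes "\<delta> > 0"
  shows "(\<Sum>k\<in>{-int R..int R}. exp (- \<delta> * \<bar>of_int k\<bar>)) \<le> 2 / (1 - exp (- \<delta>))"
proof -
  define q where "q = exp (- \<delta>)"
  have q: "0 < q" "q < 1" using assms by (auto simp: q_def)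
  have geo: "(\<Sum>j\<le>R. q ^ j) \<le> 1 / (1 - q)"
    using q by (simp add: sum_gp0 divide_simps)
  have exp: "exp (- \<delta> * real j) = q ^ j" for j
    by (simp add: q_def exp_of_nat_mult[symmetric] mult.commute)
  let ?f = "\<lambda>k::int. exp (- \<delta> * \<bar>of_int k\<bar>)"
  have inj: "inj_on int {..R}" "inj_on (\<lambda>j. - int j) {..R}" by (auto simp: inj_on_def)
  have "{-int R..int R} \<subseteq> int ` {..R} \<union> (\<lambda>j. - int j) ` {..R}"
  proof
    fix k assume "k \<in> {-int R..int R}"
    hence "nat \<bar>k\<bar> \<le> R" "k = int (nat \<bar>k\<bar>) \<or> k = - int (nat \<bar>k\<bar>)" by auto
    thus "k \<in> int ` {..R} \<union> (\<lambda>j. - int j) ` {..R}" by blast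
  qed
  hence "sum ?f {-int R..int R} \<le> sum ?f (int ` {..R} \<union> (\<lambda>j. - int j) ` {..R})"
    by (intro sum_mono2) auto
  also have "\<dots> \<le> sum ?f (int ` {..R}) + sum ?f ((\<lambda>j. - int j) ` {..R})"
  proof -
    have "0 \<le> sum ?f (int ` {..R} \<inter> (\<lambda>j. - int j) ` {..R})"
      by (rule sum_nonneg) simp
    thus ?thesis
      using sum.union_inter[OF finite_imageI[OF finite_atMost[of R], of int]
          finite_imageI[OF finite_atMost[of R], of "\<lambda>j. - int j"], of ?f] by linarith
  qed
  also have "\<dots> = 2 * (\<Sum>j\<le>R. q ^ j)"
    using exp by (simp add: sum.reindex[OF inj(1)] sum.reindex[OF inj(2)])
  finally show ?thesis using geo by (simp add: q_def)
qed

text \<open>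
  A finite set of lattice points lies in a cube, over which the sum factors into one-dimensional
  geometric sums.
\<close>
lemma (in lattice_basis) exp_decay_summable:
  fixes \<delta> :: real
  assumes "\<delta> > 0"
  shows "(\<lambda>h. exp (- \<delta> * (\<Sum>i<n. \<bar>of_int (crd i h)\<bar>))) summable_on UNIV"
proof (rule nonneg_bdd_above_summable_on)
  have "sum (\<lambda>h. exp (- \<delta> * (\<Sum>i<n. \<bar>of_int (crd i h)\<bar>))) F \<le> (2 / (1 - exp (- \<delta>))) ^ n"
    if "finite F" for F
  proof -
    define R where "R = nat (\<Sum>h\<in>F. \<Sum>i<n. \<bar>crd i h\<bar>)"
    define t where "t = (\<lambda>h. \<lambda>i\<in>{..<n}. crd i h)"
    define f where "f = (\<lambda>k::int. exp (- \<delta> * \<bar>of_int k\<bar>))"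
    have R: "\<bar>crd i h\<bar> \<le> int R" if "h \<in> F" "i < n" for h i
    proof -
      have "\<bar>crd i h\<bar> \<le> (\<Sum>i<n. \<bar>crd i h\<bar>)"
        using that(2) by (intro member_le_sum) auto
      also have "\<dots> \<le> (\<Sum>h\<in>F. \<Sum>i<n. \<bar>crd i h\<bar>)"
        using that(1) \<open>finite F\<close> by (intro member_le_sum) (auto intro: sum_nonneg)
      finally show ?thesis by (simp add: R_def)
    qed
    have "inj_on t F"
    proof (rule inj_onI)
      fix h g assume *: "t h = t g"
      have "crd i h = crd i g" if "i < n" for i
        using fun_cong[OF *, of i] that by (simp add: t_def)
      hence "zcomb n (\<lambda>i. crd i h) e = zcomb n (\<lambda>i. crd i g) e" by (simp add: zcomb_def)
      thus "h = g" by (simp only: expansion)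
    qed
    have "sum (\<lambda>h. exp (- \<delta> * (\<Sum>i<n. \<bar>of_int (crd i h)\<bar>))) F = (\<Sum>h\<in>F. \<Prod>i<n. f (t h i))"
      by (intro sum.cong) (auto simp: f_def t_def exp_sum[symmetric] sum_distrib_left)
    also have "\<dots> = (\<Sum>m\<in>t ` F. \<Prod>i<n. f (m i))"
      by (simp add: sum.reindex[OF \<open>inj_on t F\<close>])
    also have "\<dots> \<le> (\<Sum>m\<in>{..<n} \<rightarrow>\<^sub>E {-int R..int R}. \<Prod>i<n. f (m i))"
    proof (rule sum_mono2)
      show "t ` F \<subseteq> {..<n} \<rightarrow>\<^sub>E {-int R..int R}"
        using R by (auto simp: t_def abs_le_iff minus_le_iff)
    qed (auto intro!: finite_PiE prod_nonneg simp: f_def)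
    also have "\<dots> = (\<Prod>i<n. \<Sum>k\<in>{-int R..int R}. f k)"
      by (rule prod_sum_PiE[symmetric]) auto
    also have "\<dots> \<le> (2 / (1 - exp (- \<delta>))) ^ n"
      using sum_exp_abs_int_le[OF assms, of R]
      by (simp add: f_def power_mono sum_nonneg)
    finally show ?thesis .
  qed
  thus "bdd_above (sum (\<lambda>h. exp (- \<delta> * (\<Sum>i<n. \<bar>of_int (crd i h)\<bar>))) ` {F. F \<subseteq> UNIV \<and> finite F})"
    by (intro bdd_aboveI2) auto
qed auto

section \<open>Ample multipliers\<close>

context skew_pairing
begin

text \<open>
  The fibre of pairs with sum \<open>h\<close> is parametrized by the first component \<open>g\<close>, and the term at
  \<open>g\<close> is at most \<open>B |\<Phi>(g)|\<close> because \<open>\<alpha>\<close> is unitary.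
\<close>
lemma nrm_product_exists:
  assumes "complete_absolute_value nrm" and unitary: "unitary nrm \<alpha>"
    and summable: "(\<lambda>h. nrm (\<Phi> h)) summable_on UNIV" and bounded: "\<And>h. nrm (\<Psi> h) \<le> B"
  shows "\<exists>\<Theta>. has_nrm_product nrm \<alpha> \<Phi> \<Psi> \<Theta>"
proof -
  interpret absolute_value nrm using assms(1) by (simp add: complete_absolute_value_def)
  have "\<exists>l. limitin K.mtopology (sum (conv_term \<alpha> \<Phi> \<Psi>)) l
      (finite_subsets_at_top {p. fst p + snd p = h})" for h
  proof (rule nrm_summable_imp_limit)
    show "K.mcomplete" using assms(1) by (simp add: complete_absolute_value_def)
    have "{p. fst p + snd p = h} = (\<lambda>g. (g, h - g)) ` UNIV"
      by (force simp: algebra_simps)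
    moreover have "(\<lambda>g. nrm (conv_term \<alpha> \<Phi> \<Psi> (g, h - g))) summable_on UNIV"
    proof (rule summable_on_comparison_test)
      show "(\<lambda>g. B * nrm (\<Phi> g)) summable_on UNIV"
        by (rule summable_on_cmult_right[OF summable])
      show "nrm (conv_term \<alpha> \<Phi> \<Psi> (g, h - g)) \<le> B * nrm (\<Phi> g)" for g
        using unitary mult_right_mono[OF bounded nrm_nonneg, of "h - g" "\<Phi> g"]
        by (simp add: conv_term_def nrm_mult unitary_def mult.commute)
    qed (rule nrm_nonneg)
    ultimately show "(\<lambda>p. nrm (conv_term \<alpha> \<Phi> \<Psi> p)) summable_on {p. fst p + snd p = h}"
      by (simp add: summable_on_reindex inj_on_def o_def)
  qed
  thus ?thesis unfolding has_nrm_product_def by metis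
qed

lemma additive_h_l: "theta_multiplier \<alpha> L \<Longrightarrow> Modules.additive (\<lambda>b. h_l (L b))"
  by (simp add: theta_multiplier_iff Modules.additive_def)

lemma structure_form_nonzero:
  assumes "theta_multiplier \<alpha> L"
  shows "structure_form \<alpha> L b1 b2 \<noteq> 0"
  using assms left_rep_carrier(2) torusD(1)
  by (auto simp: structure_form_def nonzero theta_multiplier_iff)

text \<open>
  If \<open>h\<^sub>b = 0\<close>, then \<open>\<langle>b, b\<rangle> = x\<^sub>b(0) \<alpha>(0, 0) = 1\<close>, whose logarithm is not negative.
\<close>
lemma ample_h_l_injective:
  assumes "absolute_value nrm" "theta_multiplier \<alpha> L"
    and neg: "negative_definite (\<lambda>b1 b2. ln (nrm (structure_form \<alpha> L b1 b2)))"
    and "h_l (L b) = 0"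
  shows "b = 0"
proof (rule ccontr)
  interpret absolute_value nrm by fact
  assume "b \<noteq> 0"
  hence "ln (nrm (structure_form \<alpha> L b b)) < 0"
    using neg by (simp add: negative_definite_def)
  moreover have "structure_form \<alpha> L b b = 1"
    using assms(2,4) left_rep_carrier(2) torusD(3)
    by (auto simp: structure_form_def theta_multiplier_iff)
  moreover have "nrm 1 = 1"
    using nrm_mult[of 1 1] nrm_pos_iff[of 1] by simp
  ultimately show False by simp
qed

end

text \<open>
  Write \<open>h = h\<^sub>b + s\<close> with \<open>b\<close> in the subgroup spanned by elements \<open>w\<^sub>i\<close> that map to multiples of the
  basis vectors, and with \<open>s\<close> in a finite set of remainders.  The functional equation gives
  \<open>|\<theta>(h)| = |c\<^sub>b| |x\<^sub>b(s)| |\<theta>(s)|\<close>.  Here \<open>log |x\<^sub>b(s)|\<close> is linear in \<open>b\<close>, and \<open>log |c\<^sub>b|\<close> is half of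
  the negative definite form \<open>log |\<langle>b, b\<rangle>|\<close> plus a linear term, because its polarization is the
  logarithmic structure form.  Hence \<open>\<theta>\<close> decays like a Gaussian; exponential decay in the
  coordinates is all that is kept.
\<close>
lemma ample_theta_summable:
  fixes \<alpha> :: "'h::ab_group_add \<Rightarrow> 'h \<Rightarrow> 'k::field"
    and L :: "'b::ab_group_add \<Rightarrow> ('h, 'k) quadruple set"
  assumes "free_abelian_finite_rank TYPE('h)" and "skew_pairing \<alpha>"
    and "absolute_value nrm" and mult: "theta_multiplier \<alpha> L" and unitary: "unitary nrm \<alpha>"
    and "ample nrm \<alpha> L" and theta: "\<theta> \<in> theta_functions \<alpha> L"
  shows "(\<lambda>h. nrm (\<theta> h)) summable_on UNIV"
proof -
  interpret skew_pairing \<alpha> by fact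
  interpret absolute_value nrm by fact
  obtain n and e :: "nat \<Rightarrow> 'h" and crd where "lattice_basis n e crd"
    using exists_lattice_basis[OF assms(1)] by blast
  then interpret lattice_basis n e crd .
  define hL where "hL b = h_l (L b)" for b
  have hL: "Modules.additive hL"
    using additive_h_l[OF mult] by (simp add: hL_def[abs_def])
  have "finite (rcosets\<^bsub>add_group\<^esub> (range hL))"
    using assms(6) by (simp add: ample_def hL_def[abs_def])
  hence "\<forall>i. \<exists>N b. N > 0 \<and> hL b = zmul N (e i)"
    using multiple_in_finite_index_range[OF hL] by metis
  then obtain N w where N: "\<And>i. N i > 0" and w: "\<And>i. hL (w i) = zmul (N i) (e i)"
    by metis

  define \<beta> where "\<beta> b b' = ln (nrm (structure_form \<alpha> L b b'))" for b b'
  define \<gamma> where "\<gamma> b = ln (nrm (c_l (L b)))" for b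
  define \<xi> where "\<xi> u b = ln (nrm (x_l (L b) u))" for u b
  have L: "L b \<in> carrier (G_grp \<alpha>)" for b
    using mult by (simp add: theta_multiplier_iff)
  have c0: "c_l (L b) \<noteq> 0" and x0: "x_l (L b) u \<noteq> 0" for b u
    by (rule left_rep_carrier[OF L], rule torusD[OF left_rep_carrier(2)[OF L]])
  have \<gamma>: "\<gamma> (b + b') = \<gamma> b + \<gamma> b' + \<beta> b b'" for b b'
    using mult by (simp add: \<gamma>_def \<beta>_def theta_multiplier_iff ln_nrm_mult c0
        structure_form_nonzero[OF mult])
  have \<xi>: "Modules.additive (\<xi> u)" for u
    using mult by (simp add: Modules.additive_def \<xi>_def theta_multiplier_iff ln_nrm_mult x0)
  have \<beta>_sym: "\<beta> b b' = \<beta> b' b" for b b'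
    using \<gamma>[of b b'] \<gamma>[of b' b] by (simp add: add.commute)
  have \<beta>_add_right: "Modules.additive (\<beta> b)" for b
  proof -
    have "\<beta> b b' = ln (nrm (x_l (L b) (hL b')))" for b'
      using unitary by (simp add: \<beta>_def structure_form_def nrm_mult unitary_def hL_def)
    moreover have "x_l (L b) \<in> torus"
      using mult left_rep_carrier(2) by (auto simp: theta_multiplier_iff)
    ultimately show ?thesis
      by (simp add: Modules.additive_def Modules.additive.add[OF hL] torusD(2) ln_nrm_mult x0)
  qed
  have \<beta>_add_left: "Modules.additive (\<lambda>b. \<beta> b b')" for b'
    using \<beta>_add_right[of b'] by (simp add: \<beta>_sym[of _ b'])
  define \<delta> where "\<delta> b = \<gamma> b - \<beta> b b / 2" for b
  have \<delta>: "Modules.additive \<delta>"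
    unfolding Modules.additive_def \<delta>_def \<gamma> Modules.additive.add[OF \<beta>_add_left]
      Modules.additive.add[OF \<beta>_add_right]
    by (simp add: \<beta>_sym field_simps)

  have neg: "negative_definite \<beta>"
    using assms(6) by (simp add: ample_def \<beta>_def[abs_def])
  have "(\<Sum>i<n. \<Sum>j<n. t i * t j * \<beta> (w i) (w j)) < 0" if "\<exists>i<n. t i \<noteq> 0" for t
  proof (rule negative_definite_combination[OF neg _ _ that])
    show "Modules.additive (\<lambda>b. real_of_int (crd i (hL b)))" for i
      by (simp add: Modules.additive_def Modules.additive.add[OF hL]
          Modules.additive.add[OF additive_crd])
    show "real_of_int (crd i (hL (w j))) = 0 \<longleftrightarrow> i \<noteq> j" if "i < n" "j < n" for i j
      using N[of j] that by (simp add: w additive_zmul[OF additive_crd] crd_basis)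
  qed
  from negative_form_bound[OF this] obtain \<epsilon> where \<epsilon>: "\<epsilon> > 0"
    "\<And>t. (\<Sum>i<n. \<Sum>j<n. t i * t j * \<beta> (w i) (w j)) \<le> - \<epsilon> * (\<Sum>i<n. (t i)\<^sup>2)"
    by blast

  define l where "l s i = \<delta> (w i) + \<xi> s (w i)" for s i
  define K where "K s = (\<Sum>i<n. (\<bar>l s i\<bar> + 1)\<^sup>2 / (4 * (\<epsilon> / 2)))" for s
  have decay: "nrm (\<theta> (hL (zcomb n m w) + s)) \<le> exp (K s - (\<Sum>i<n. \<bar>of_int (m i)\<bar>)) * nrm (\<theta> s)"
    for m s
  proof -
    define b where "b = zcomb n m w"
    define t where "t i = real_of_int (m i)" for i
    have "\<theta> (hL b + s) = c_l (L b) * \<alpha> (hL b) s * x_l (L b) s * \<theta> s"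
      using theta theta_functions_iff[OF mult] by (simp add: hL_def)
    hence "nrm (\<theta> (hL b + s)) = exp (\<gamma> b + \<xi> s b) * nrm (\<theta> s)"
      using unitary c0[of b] x0[of b s]
      by (simp add: nrm_mult unitary_def \<gamma>_def \<xi>_def exp_add nrm_pos_iff)
    moreover have "\<gamma> b + \<xi> s b \<le> K s - (\<Sum>i<n. \<bar>t i\<bar>)"
    proof -
      have "\<beta> b b = (\<Sum>i<n. \<Sum>j<n. t i * t j * \<beta> (w i) (w j))"
        unfolding b_def additive_zcomb[OF \<beta>_add_left] additive_zcomb[OF \<beta>_add_right]
          zcomb_real t_def sum_distrib_left
        by (intro sum.cong refl) (simp add: \<beta>_sym mult_ac)
      hence "\<beta> b b \<le> - \<epsilon> * (\<Sum>i<n. (t i)\<^sup>2)" using \<epsilon>(2) by simp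
      moreover have "\<delta> b + \<xi> s b = (\<Sum>i<n. l s i * t i)"
        unfolding b_def additive_zcomb[OF \<delta>] additive_zcomb[OF \<xi>] zcomb_real t_def l_def
        by (simp add: sum.distrib[symmetric] algebra_simps)
      moreover have "(\<Sum>i<n. - (\<epsilon> / 2) * (t i)\<^sup>2 + l s i * t i) =
          - (\<epsilon> / 2) * (\<Sum>i<n. (t i)\<^sup>2) + (\<Sum>i<n. l s i * t i)"
        unfolding sum.distrib sum_distrib_left ..
      ultimately have "\<gamma> b + \<xi> s b \<le> (\<Sum>i<n. - (\<epsilon> / 2) * (t i)\<^sup>2 + l s i * t i)"
        unfolding \<delta>_def by linarith
      also have "\<dots> \<le> (\<Sum>i<n. (\<bar>l s i\<bar> + 1)\<^sup>2 / (4 * (\<epsilon> / 2)) - \<bar>t i\<bar>)"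
        using \<epsilon>(1) by (intro sum_mono quadratic_beats_linear) simp
      also have "\<dots> = K s - (\<Sum>i<n. \<bar>t i\<bar>)"
        by (simp add: K_def sum_subtractf)
      finally show ?thesis .
    qed
    ultimately show ?thesis
      by (simp add: b_def t_def mult_right_mono nrm_nonneg)
  qed

  \<comment> \<open>The remainders \<open>s\<close>: combinations of the basis with \<open>i\<close>-th coefficient in \<open>{0..<N i}\<close>, enlarged
    to a common range of coefficients.\<close>
  define P where "P = (\<lambda>f. zcomb n f e) ` ({..<n} \<rightarrow>\<^sub>E (\<Union>i<n. {0..<N i}))"
  have "finite P" unfolding P_def by (intro finite_imageI finite_PiE) auto
  define C where "C = (\<Sum>s\<in>P. exp (K s) * nrm (\<theta> s))"
  \<comment> \<open>Passing from \<open>m\<^sub>i = crd i h div N i\<close> back to \<open>crd i h\<close> costs a factor at most \<open>D\<close> and an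
    additive error of \<open>1\<close>; the summand \<open>1\<close> in \<open>D\<close> keeps it positive for \<open>n = 0\<close>.\<close>
  define D where "D = (\<Sum>i<n. N i) + 1"
  have D: "D > 0" "\<And>i. i < n \<Longrightarrow> N i \<le> D"
  proof -
    have "(\<Sum>i<n. N i) \<ge> 0" by (rule sum_nonneg) (rule less_imp_le[OF N])
    thus "D > 0" by (simp add: D_def)
    fix i assume "i < n"
    hence "N i \<le> (\<Sum>i<n. N i)" using N by (intro member_le_sum) (auto intro: less_imp_le)
    thus "N i \<le> D" by (simp add: D_def)
  qed
  have bound: "nrm (\<theta> h) \<le> C * exp n * exp (- (1 / D) * (\<Sum>i<n. \<bar>of_int (crd i h)\<bar>))" for h
  proof -
    define m where "m i = crd i h div N i" for i
    define s where "s = zcomb n (\<lambda>i\<in>{..<n}. crd i h mod N i) e"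
    have "zcomb n (\<lambda>i\<in>{..<n}. crd i h mod N i) e = zcomb n (\<lambda>i. crd i h mod N i) e"
      by (simp add: zcomb_def)
    hence "hL (zcomb n m w) + s = zcomb n (\<lambda>i. m i * N i + crd i h mod N i) e"
      by (simp add: additive_zcomb[OF hL] w zcomb_zmul zcomb_add s_def)
    also have "\<dots> = h" by (simp add: m_def expansion)
    finally have h: "hL (zcomb n m w) + s = h" .
    have "s \<in> P" unfolding P_def s_def using N by (intro imageI) auto
    hence C: "exp (K s) * nrm (\<theta> s) \<le> C"
      unfolding C_def using \<open>finite P\<close> by (intro member_le_sum) (auto simp: nrm_nonneg)
    have "\<bar>real_of_int (crd i h)\<bar> / D - 1 \<le> \<bar>real_of_int (m i)\<bar>" if "i < n" for i
    proof -
      have "crd i h = N i * m i + crd i h mod N i" "0 \<le> crd i h mod N i" "crd i h mod N i < N i"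
        using N[of i] by (auto simp: m_def)
      moreover have "\<bar>N i * m i\<bar> = N i * \<bar>m i\<bar>"
        using N[of i] by (simp add: abs_mult)
      ultimately have "\<bar>crd i h\<bar> \<le> N i * \<bar>m i\<bar> + N i" by linarith
      also have "\<dots> \<le> D * \<bar>m i\<bar> + D"
        using D(2)[OF that] by (intro add_mono mult_right_mono) auto
      finally have "real_of_int \<bar>crd i h\<bar> \<le> real_of_int (D * \<bar>m i\<bar> + D)"
        by (simp only: of_int_le_iff UNIV_I)
      thus ?thesis using D(1) by (simp add: field_simps)
    qed
    hence "(\<Sum>i<n. \<bar>real_of_int (crd i h)\<bar> / D - 1) \<le> (\<Sum>i<n. \<bar>real_of_int (m i)\<bar>)"
      by (intro sum_mono) auto
    hence le: "- (\<Sum>i<n. \<bar>real_of_int (m i)\<bar>) \<le> n - (1 / D) * (\<Sum>i<n. \<bar>real_of_int (crd i h)\<bar>)"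
      by (simp add: sum_subtractf sum_divide_distrib)
    have "nrm (\<theta> h) \<le> (exp (K s) * nrm (\<theta> s)) * exp (- (\<Sum>i<n. \<bar>real_of_int (m i)\<bar>))"
      using decay[of m s] unfolding h by (simp add: exp_diff exp_minus field_simps)
    also have "\<dots> \<le> C * exp (n - (1 / D) * (\<Sum>i<n. \<bar>real_of_int (crd i h)\<bar>))"
      using C le by (intro mult_mono) (auto simp: nrm_nonneg C_def sum_nonneg)
    finally show ?thesis by (simp add: exp_diff exp_minus field_simps)
  qed
  have "(\<lambda>h. exp (- (1 / D) * (\<Sum>i<n. \<bar>of_int (crd i h)\<bar>))) summable_on UNIV"
    using D(1) by (intro exp_decay_summable) simp
  hence "(\<lambda>h. C * exp n * exp (- (1 / D) * (\<Sum>i<n. \<bar>of_int (crd i h)\<bar>))) summable_on UNIV"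
    by (rule summable_on_cmult_right)
  thus ?thesis
    by (rule summable_on_comparison_test) (rule bound nrm_nonneg)+
qed

context composable_multipliers
begin

text \<open>
  Unitarity removes the mixed terms from the structure form, and a sum of negative definite forms is
  negative definite.  Injectivity of \<open>b \<mapsto> h\<^sub>b\<close> then yields the other two
  conditions, the finite index by comparison with \<open>h'\<close>.
\<close>
lemma ample_L:
  assumes "free_abelian_finite_rank TYPE('h)"
    and "absolute_value nrm" and unitary: "unitary nrm \<alpha>"
    and ample'': "ample nrm \<alpha> L''" and ample': "ample nrm \<alpha> L'"
  shows "ample nrm \<alpha> L"
proof -
  interpret absolute_value nrm by fact
  obtain n and e :: "nat \<Rightarrow> 'h" and crd where "lattice_basis n e crd"
    using exists_lattice_basis[OF assms(1)] by blast
  then interpret lattice_basis n e crd .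
  have "ln (nrm (structure_form \<alpha> L b1 b2)) =
      ln (nrm (structure_form \<alpha> L'' b1 b2)) + ln (nrm (structure_form \<alpha> L' b1 b2))" for b1 b2
    using unitary structure_form_nonzero[OF multiplier''] structure_form_nonzero[OF multiplier']
    by (simp add: structure_form_L nrm_mult unitary_def ln_mult nrm_eq_0_iff)
  hence neg: "negative_definite (\<lambda>b1 b2. ln (nrm (structure_form \<alpha> L b1 b2)))"
    using ample'' ample' unfolding ample_def negative_definite_def
    by (auto simp: distrib_left sum.distrib intro!: add_neg_neg)
  have ker: "b = 0" if "h_l (L b) = 0" for b
    by (rule ample_h_l_injective[OF assms(2) multiplier_L neg that])
  have "b1 = b2" if "h_l (L b1) = h_l (L b2)" for b1 b2
    using ker[of "b1 - b2"] Modules.additive.diff[OF additive_h_l[OF multiplier_L], of b1 b2] that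
    by simp
  moreover have "finite (rcosets\<^bsub>add_group\<^esub> (range (\<lambda>b. h_l (L b))))"
    using ample' ker
    by (intro finite_index_range[OF additive_h_l[OF multiplier_L] _ additive_h_l[OF multiplier']])
       (auto simp: ample_def)
  ultimately show ?thesis
    unfolding ample_def using neg by blast
qed

end

theorem theorem3p1p1:
  fixes \<alpha> :: "'h::ab_group_add \<Rightarrow> 'h \<Rightarrow> 'k::field"
    and L'' L' L :: "'b::ab_group_add \<Rightarrow> ('h, 'k) quadruple set"
  assumes "free_abelian_finite_rank TYPE('h)"
    and "skew_pairing \<alpha>"
    and "theta_multiplier \<alpha> L''"
    and "theta_multiplier \<alpha> L'"
    and "\<And>b. composable (L'' b) (L' b)"
    and "\<And>b. L b = G_compose \<alpha> (L'' b) (L' b)"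
  shows
    "theta_multiplier \<alpha> L \<and>
     (\<forall>b1 b2. structure_form \<alpha> L b1 b2 =
        structure_form \<alpha> L'' b1 b2 * structure_form \<alpha> L' b1 b2
          * \<alpha> (h_l (L' b2)) (h_l (L'' b1)) * \<alpha> (h_l (L' b1)) (h_l (L'' b2))) \<and>
     (\<forall>\<theta>'\<in>theta_functions \<alpha> L'. \<forall>\<theta>''\<in>theta_functions \<alpha> L''. \<forall>\<theta>.
        has_formal_product \<alpha> \<theta>' \<theta>'' \<theta> \<longrightarrow> \<theta> \<in> theta_functions \<alpha> L) \<and>
     (\<forall>nrm. complete_absolute_value nrm \<longrightarrow>
        (\<forall>\<theta>'\<in>theta_functions \<alpha> L'. \<forall>\<theta>''\<in>theta_functions \<alpha> L''. \<forall>\<theta>.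
           has_nrm_product nrm \<alpha> \<theta>' \<theta>'' \<theta> \<longrightarrow> \<theta> \<in> theta_functions \<alpha> L)) \<and>
     (\<forall>nrm. complete_absolute_value nrm \<longrightarrow>
        unitary nrm \<alpha> \<longrightarrow> ample nrm \<alpha> L'' \<longrightarrow> ample nrm \<alpha> L' \<longrightarrow>
          ample nrm \<alpha> L \<and>
          (\<forall>\<theta>'\<in>theta_functions \<alpha> L'. \<forall>\<theta>''\<in>theta_functions \<alpha> L''.
             \<exists>\<theta>. has_nrm_product nrm \<alpha> \<theta>' \<theta>'' \<theta>))"
proof -
  interpret composable_multipliers \<alpha> L'' L' L
    using assms(2-6) by (simp add: composable_multipliers_def composable_multipliers_axioms_def)
  show ?thesis
  proof (intro conjI allI ballI impI)
    show "theta_multiplier \<alpha> L" by (rule multiplier_L)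
    show "structure_form \<alpha> L b1 b2 =
        structure_form \<alpha> L'' b1 b2 * structure_form \<alpha> L' b1 b2
          * \<alpha> (h_l (L' b2)) (h_l (L'' b1)) * \<alpha> (h_l (L' b1)) (h_l (L'' b2))" for b1 b2
      by (rule structure_form_L)
    fix \<theta>' \<theta>'' assume theta: "\<theta>' \<in> theta_functions \<alpha> L'" "\<theta>'' \<in> theta_functions \<alpha> L''"
    show "\<theta> \<in> theta_functions \<alpha> L" if "has_formal_product \<alpha> \<theta>' \<theta>'' \<theta>" for \<theta>
      by (rule formal_product_theta[OF theta that])
    fix nrm :: "'k \<Rightarrow> real" assume complete: "complete_absolute_value nrm"
    hence abs: "absolute_value nrm" by (simp add: complete_absolute_value_def)
    show "\<theta> \<in> theta_functions \<alpha> L" if "has_nrm_product nrm \<alpha> \<theta>' \<theta>'' \<theta>" for \<theta>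
      by (rule nrm_product_theta[OF abs theta that])
    assume unitary: "unitary nrm \<alpha>" and ample: "ample nrm \<alpha> L''" "ample nrm \<alpha> L'"
    interpret absolute_value nrm by (rule abs)
    have sum'': "(\<lambda>h. nrm (\<theta>'' h)) summable_on UNIV"
      by (rule ample_theta_summable[OF assms(1,2) abs multiplier'' unitary ample(1) theta(2)])
    have "nrm (\<theta>'' h) \<le> infsum (\<lambda>h. nrm (\<theta>'' h)) UNIV" for h
      using finite_sum_le_infsum[OF sum'', of "{h}"] by (simp add: nrm_nonneg)
    thus "\<exists>\<theta>. has_nrm_product nrm \<alpha> \<theta>' \<theta>'' \<theta>"
      by (rule nrm_product_exists[OF complete unitary
            ample_theta_summable[OF assms(1,2) abs multiplier' unitary ample(2) theta(1)]])
  next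
    fix nrm :: "'k \<Rightarrow> real"
    assume "complete_absolute_value nrm" "unitary nrm \<alpha>" "ample nrm \<alpha> L''" "ample nrm \<alpha> L'"
    thus "ample nrm \<alpha> L"
      using ample_L[OF assms(1)] by (simp add: complete_absolute_value_def)
  qed
qed

end
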